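(* Let $\Omega$ be a finite set and let $\mathcal{P}$ be a probability distribution on $\Omega^2$ whose two marginals are both equal to a distribution $\pi$ with support $\Omega$. Then $\mathcal{P}$ is same-set hitting if and only if $\alpha(\mathcal{P}) := \min_{x \in \Omega} \mathcal{P}(x,x) > 0$.
   Context: For $n \in \mathbb{N}$, let $(X_i, Y_i)$, $i = 1, \ldots, n$, be i.i.d. pairs distributed according to $\mathcal{P}$, and write $\underline{X} = (X_1,\ldots,X_n)$, $\underline{Y} = (Y_1,\ldots,Y_n)$. For $\mu, \delta \in (0,1]$, $\mathcal{P}$ is called $(\mu,\delta)$-same-set hitting if for all $n \ge 1$ and every function $f: \Omega^n \to [0,1]$ with $\mathbb{E}[f(\underline{X})] \ge \mu$ and $\mathbb{E}[f(\underline{Y})] \ge \mu$ we have $\mathbb{E}[f(\underline{X}) f(\underline{Y})] \ge \delta$. $\mathcal{P}$ is called same-set hitting if for every $\mu \in (0,1]$ there exists $\delta \in (0,1]$ such that $\mathcal{P}$ is $(\mu,\delta)$-same-set hitting. *)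

theory Defs
  imports "HOL-Probability.Probability"
begin

text \<open>
  \<open>\<Omega>\<^sup>n\<close> is represented by the lists of length \<open>n\<close> over \<open>\<Omega>\<close>.  For i.i.d. pairs with law
  \<open>P\<close>, \<open>replicate_pmf n P\<close> is the law of the list \<open>[(X\<^sub>1, Y\<^sub>1), \<dots>, (X\<^sub>n, Y\<^sub>n)]\<close>, so that
  projecting its entries yields the two vectors \<open>X\<close> and \<open>Y\<close>.
\<close>

definition is_same_set_hitting :: "'a set \<Rightarrow> ('a \<times> 'a) pmf \<Rightarrow> real \<Rightarrow> real \<Rightarrow> bool" where
  "is_same_set_hitting \<Omega> P \<mu> \<delta> \<longleftrightarrow>
     (\<forall>n\<ge>1. \<forall>f :: 'a list \<Rightarrow> real.
        (\<forall>xs. length xs = n \<and> set xs \<subseteq> \<Omega> \<longrightarrow> f xs \<in> {0..1}) \<longrightarrow>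
        measure_pmf.expectation (replicate_pmf n P) (\<lambda>zs. f (map fst zs)) \<ge> \<mu> \<longrightarrow>
        measure_pmf.expectation (replicate_pmf n P) (\<lambda>zs. f (map snd zs)) \<ge> \<mu> \<longrightarrow>
        measure_pmf.expectation (replicate_pmf n P) (\<lambda>zs. f (map fst zs) * f (map snd zs)) \<ge> \<delta>)"

definition same_set_hitting :: "'a set \<Rightarrow> ('a \<times> 'a) pmf \<Rightarrow> bool" where
  "same_set_hitting \<Omega> P \<longleftrightarrow>
     (\<forall>\<mu>\<in>{0<..1}. \<exists>\<delta>\<in>{0<..1}. is_same_set_hitting \<Omega> P \<mu> \<delta>)"

definition diag_min :: "'a set \<Rightarrow> ('a \<times> 'a) pmf \<Rightarrow> real" where
  "diag_min \<Omega> P = (MIN x\<in>\<Omega>. pmf P (x, x))"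

end

theory Submission
  imports Defs
begin

text \<open>
  If \<open>P (x, x) = 0\<close>, the indicator of \<open>[x]\<close> is a counterexample with \<open>n = 1\<close>.

  Conversely, conditioning every coordinate on its connected component in the support of \<open>P\<close>
  reduces the claim to products of connected pair laws with diagonal bounded below.  Let \<open>N f\<close> be
  \<open>f\<close> with a small fraction of the coordinates resampled.  If some coordinate has large influence
  on \<open>N f\<close>, fixing it on both sides to a suitable common value, at the cost of a constant factor,
  increases \<open>E f + E (N f)\<^sup>2 \<le> 2\<close> by a constant; so after boundedly many steps all influences are
  small and \<open>E f\<close> is still at least half of its original bound.

  In that case, expose the coordinates one at a time and let \<open>F\<^sub>i\<close> be the Doob martingale of
  \<open>F = \<theta> + (1 - \<theta>) N f\<close>.  For a large exponent \<open>C\<close>, the product \<open>F\<^sub>i(X)\<^sup>C F\<^sub>i(Y)\<^sup>C\<close> is a submartingale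
  except at steps where the next coordinate has a noticeable effect on both \<open>X\<close> and \<open>Y\<close>.
  By hypercontractivity the probability of such a conflict at step \<open>i\<close> is at most \<open>b\<^sub>i\<^sup>1\<^sup>+\<^sup>\<kappa>\<close>, where \<open>b\<^sub>i\<close> is
  the probability that the step is noticeable for \<open>X\<close>; the \<open>b\<^sub>i\<close> are uniformly small and their sum
  is bounded, so conflicts are negligible.  Finally \<open>E (f(X) f(Y))\<close> and \<open>E (N f(X) N f(Y))\<close> are close
  because the maximal correlation of a connected law is less than 1.
\<close>

section \<open>Pair laws on a finite alphabet\<close>

locale alphabet =
  fixes A :: "'a set"
  assumes finite_A: "finite A"
begin

definition mg :: "('a \<Rightarrow> 'a \<Rightarrow> real) \<Rightarrow> 'a \<Rightarrow> real" where
  "mg P x = (\<Sum>y\<in>A. P x y)"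

definition ex1 :: "('a \<Rightarrow> 'a \<Rightarrow> real) \<Rightarrow> ('a \<Rightarrow> real) \<Rightarrow> real" where
  "ex1 P u = (\<Sum>x\<in>A. mg P x * u x)"

definition ex2 :: "('a \<Rightarrow> 'a \<Rightarrow> real) \<Rightarrow> ('a \<Rightarrow> 'a \<Rightarrow> real) \<Rightarrow> real" where
  "ex2 P h = (\<Sum>x\<in>A. \<Sum>y\<in>A. P x y * h x y)"

text \<open>A pair law is a bare real function, so that conditioning on a component and mixing are
  finite sums and quotients. Equality of the marginals lets \<open>mg\<close>, \<open>ex1\<close>
  and \<open>supp\<close> serve both coordinates.\<close>

definition kern :: "('a \<Rightarrow> 'a \<Rightarrow> real) \<Rightarrow> bool" where
  "kern P \<longleftrightarrow> (\<forall>x y. 0 \<le> P x y) \<and> ex2 P (\<lambda>_ _. 1) = 1 \<and> (\<forall>y\<in>A. (\<Sum>x\<in>A. P x y) = mg P y)"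

definition supp :: "('a \<Rightarrow> 'a \<Rightarrow> real) \<Rightarrow> 'a set" where
  "supp P = {x \<in> A. 0 < mg P x}"

lemma ex1_add: "ex1 P (\<lambda>x. u x + v x) = ex1 P u + ex1 P v"
  by (simp add: ex1_def sum.distrib algebra_simps)

lemma ex1_diff: "ex1 P (\<lambda>x. u x - v x) = ex1 P u - ex1 P v"
  by (simp add: ex1_def sum_subtractf algebra_simps)

lemma ex1_cmult: "ex1 P (\<lambda>x. c * u x) = c * ex1 P u"
  by (simp add: ex1_def sum_distrib_left algebra_simps)

lemma ex1_sum: "ex1 P (\<lambda>x. \<Sum>i\<in>I. u i x) = (\<Sum>i\<in>I. ex1 P (u i))"
  by (simp add: ex1_def sum_distrib_left sum.swap[of _ I])

lemma ex2_add: "ex2 P (\<lambda>x y. g x y + h x y) = ex2 P g + ex2 P h"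
  by (simp add: ex2_def sum.distrib algebra_simps)

lemma ex2_diff: "ex2 P (\<lambda>x y. g x y - h x y) = ex2 P g - ex2 P h"
  by (simp add: ex2_def sum_subtractf algebra_simps)

lemma ex2_cmult: "ex2 P (\<lambda>x y. c * h x y) = c * ex2 P h"
  by (simp add: ex2_def sum_distrib_left algebra_simps)

lemma ex2_sum: "ex2 P (\<lambda>x y. \<Sum>i\<in>I. h i x y) = (\<Sum>i\<in>I. ex2 P (h i))"
  by (simp add: ex2_def sum_distrib_left sum.swap[of _ I])

lemma ex2_fst: "ex2 P (\<lambda>x y. u x) = ex1 P u"
  by (simp add: ex2_def ex1_def mg_def sum_distrib_right)

lemma kern_nonneg: "kern P \<Longrightarrow> 0 \<le> P x y"
  by (simp add: kern_def)

lemma mg_nonneg: "kern P \<Longrightarrow> 0 \<le> mg P x"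
  by (simp add: mg_def sum_nonneg kern_nonneg)

lemma ex2_snd: "kern P \<Longrightarrow> ex2 P (\<lambda>x y. v y) = ex1 P v"
proof -
  assume k: "kern P"
  have "ex2 P (\<lambda>x y. v y) = (\<Sum>y\<in>A. (\<Sum>x\<in>A. P x y) * v y)"
    unfolding ex2_def sum_distrib_right by (rule sum.swap)
  also have "\<dots> = ex1 P v"
    using k by (simp add: ex1_def kern_def)
  finally show ?thesis .
qed

lemma ex2_const: "kern P \<Longrightarrow> ex2 P (\<lambda>x y. c) = c"
  using ex2_cmult[of P c "\<lambda>_ _. 1"] by (simp add: kern_def)

lemma ex1_const: "kern P \<Longrightarrow> ex1 P (\<lambda>x. c) = c"
  using ex2_const[of P c] ex2_fst[of P "\<lambda>_. c"] by simp

lemma kern_eq_0: "kern P \<Longrightarrow> x \<in> A \<Longrightarrow> y \<in> A \<Longrightarrow> x \<notin> supp P \<or> y \<notin> supp P \<Longrightarrow> P x y = 0"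
proof -
  assume k: "kern P" and A: "x \<in> A" "y \<in> A" and s: "x \<notin> supp P \<or> y \<notin> supp P"
  have "P x y \<le> mg P x"
    unfolding mg_def using finite_A A k by (intro member_le_sum) (auto simp: kern_nonneg)
  moreover have "P x y \<le> (\<Sum>x\<in>A. P x y)"
    using finite_A A k by (intro member_le_sum[of x A "\<lambda>x. P x y"]) (auto simp: kern_nonneg)
  moreover have "(\<Sum>x\<in>A. P x y) = mg P y"
    using k A by (simp add: kern_def)
  ultimately show ?thesis
    using s A kern_nonneg[OF k, of x y] by (auto simp: supp_def)
qed

text \<open>By \<open>kern_eq_0\<close> pairs outside the support carry no mass, so a comparison on
  the support is enough; estimates for a conditioned law are available only there.\<close>

lemma ex2_mono:
  assumes "kern P" "\<And>x y. x \<in> supp P \<Longrightarrow> y \<in> supp P \<Longrightarrow> g x y \<le> h x y"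
  shows "ex2 P g \<le> ex2 P h"
  unfolding ex2_def
proof (intro sum_mono)
  fix x y assume A: "x \<in> A" "y \<in> A"
  show "P x y * g x y \<le> P x y * h x y"
  proof (cases "x \<in> supp P \<and> y \<in> supp P")
    case True
    then show ?thesis using assms by (intro mult_left_mono) (auto simp: kern_nonneg)
  next
    case False
    then show ?thesis using kern_eq_0[OF assms(1) A] by auto
  qed
qed

lemma ex1_mono:
  assumes "kern P" "\<And>x. x \<in> supp P \<Longrightarrow> u x \<le> v x"
  shows "ex1 P u \<le> ex1 P v"
  using ex2_mono[OF assms(1), of "\<lambda>x y. u x" "\<lambda>x y. v x"] assms(2) by (simp add: ex2_fst)

lemma ex2_cong:
  assumes "kern P" "\<And>x y. x \<in> supp P \<Longrightarrow> y \<in> supp P \<Longrightarrow> g x y = h x y"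
  shows "ex2 P g = ex2 P h"
  by (rule antisym; rule ex2_mono) (use assms in auto)

lemma ex1_nonneg: "kern P \<Longrightarrow> (\<And>x. x \<in> supp P \<Longrightarrow> 0 \<le> u x) \<Longrightarrow> 0 \<le> ex1 P u"
  using ex1_mono[of P "\<lambda>_. 0" u] by (simp add: ex1_const)

lemma ex2_nonneg: "kern P \<Longrightarrow> (\<And>x y. x \<in> supp P \<Longrightarrow> y \<in> supp P \<Longrightarrow> 0 \<le> h x y) \<Longrightarrow> 0 \<le> ex2 P h"
  using ex2_mono[of P "\<lambda>_ _. 0" h] by (simp add: ex2_const)

lemma ex1_ge_point:
  assumes "kern P" "x \<in> supp P" "\<And>x. x \<in> supp P \<Longrightarrow> 0 \<le> u x"
  shows "mg P x * u x \<le> ex1 P u"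
proof -
  have "0 \<le> mg P y * u y" if "y \<in> A" for y
  proof (cases "y \<in> supp P")
    case True then show ?thesis using assms mg_nonneg by simp
  next
    case False then show ?thesis using that mg_nonneg[OF assms(1), of y] by (simp add: supp_def)
  qed
  then show ?thesis
    unfolding ex1_def using finite_A assms(2)
    by (intro member_le_sum[of x A "\<lambda>x. mg P x * u x"]) (auto simp: supp_def)
qed

lemma ex2_ge_point:
  assumes "kern P" "x \<in> A" "y \<in> A" "\<And>x y. 0 \<le> h x y"
  shows "P x y * h x y \<le> ex2 P h"
proof -
  have "P x y * h x y \<le> (\<Sum>y\<in>A. P x y * h x y)"
    using assms finite_A by (intro member_le_sum[of y A "\<lambda>y. P x y * h x y"]) (auto simp: kern_nonneg)
  also have "\<dots> \<le> ex2 P h"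
    unfolding ex2_def using assms finite_A
    by (intro member_le_sum[of x A "\<lambda>x. \<Sum>y\<in>A. P x y * h x y"]) (auto simp: kern_nonneg intro!: sum_nonneg)
  finally show ?thesis .
qed

lemma ex1_exists_ge:
  assumes "kern P" "c \<le> ex1 P u"
  shows "\<exists>x\<in>supp P. c \<le> u x"
proof (rule ccontr)
  assume "\<not> ?thesis"
  then have l: "u x < c" if "x \<in> supp P" for x using that by force
  have "supp P \<noteq> {}"
  proof
    assume "supp P = {}"
    then have "ex1 P (\<lambda>_. 1) \<le> ex1 P (\<lambda>_. 0)" by (intro ex1_mono assms) auto
    then show False using assms by (simp add: ex1_const)
  qed
  then obtain x where x: "x \<in> supp P" by blast
  have "mg P x * (c - u x) \<le> ex1 P (\<lambda>x. c - u x)"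
    by (intro ex1_ge_point assms x) (use l in \<open>auto intro: less_imp_le\<close>)
  also have "\<dots> \<le> 0" using assms by (simp add: ex1_diff ex1_const)
  finally show False using x l[OF x] by (simp add: supp_def mult_le_0_iff)
qed

lemma ex1_exists_le:
  assumes "kern P" "ex1 P u \<le> c"
  shows "\<exists>x\<in>supp P. u x \<le> c"
  using ex1_exists_ge[of P "- c" "\<lambda>x. - 1 * u x"] assms by (simp only: ex1_cmult) auto

lemma ex1_variance: "kern P \<Longrightarrow> ex1 P (\<lambda>x. (u x - ex1 P u)\<^sup>2) = ex1 P (\<lambda>x. (u x)\<^sup>2) - (ex1 P u)\<^sup>2"
proof -
  assume k: "kern P"
  have "ex1 P (\<lambda>x. (u x - ex1 P u)\<^sup>2) = ex1 P (\<lambda>x. ((u x)\<^sup>2 + (ex1 P u)\<^sup>2) - (2 * ex1 P u) * u x)"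
    by (rule arg_cong[of _ _ "ex1 P"]) (auto simp: power2_diff algebra_simps)
  also have "\<dots> = ex1 P (\<lambda>x. (u x)\<^sup>2) - (ex1 P u)\<^sup>2"
    by (simp only: ex1_diff ex1_add ex1_cmult ex1_const[OF k]) (simp add: power2_eq_square)
  finally show ?thesis .
qed

end

section \<open>Connected pair laws and hypercontractivity\<close>

locale connected_alphabet = alphabet +
  fixes lam L :: real
  assumes lam: "0 < lam" "lam \<le> 1" and L: "1 \<le> L"
begin

text \<open>
  The last condition is a quantitative form of the connectedness of the support of \<open>P\<close>, viewed
  as a bipartite graph: a pair of functions that agree along most edges is nearly constant.
\<close>

definition good :: "('a \<Rightarrow> 'a \<Rightarrow> real) \<Rightarrow> bool" where
  "good P \<longleftrightarrow> kern P \<and> (\<forall>x\<in>supp P. lam \<le> P x x) \<and>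
     (\<forall>u v. \<forall>x\<in>supp P. \<forall>y\<in>supp P. (u x - v y)\<^sup>2 \<le> L * ex2 P (\<lambda>a b. (u a - v b)\<^sup>2))"

lemma good_kern: "good P \<Longrightarrow> kern P"
  by (simp add: good_def)

lemma good_mg: "good P \<Longrightarrow> x \<in> supp P \<Longrightarrow> lam \<le> mg P x"
proof -
  assume g: "good P" and x: "x \<in> supp P"
  have "P x x \<le> mg P x"
    unfolding mg_def using finite_A g x
    by (intro member_le_sum) (auto simp: kern_nonneg good_def supp_def)
  then show ?thesis using g x by (auto simp: good_def)
qed

lemma good_connected:
  "good P \<Longrightarrow> x \<in> supp P \<Longrightarrow> y \<in> supp P \<Longrightarrow> (u x - v y)\<^sup>2 \<le> L * ex2 P (\<lambda>a b. (u a - v b)\<^sup>2)"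
  by (simp add: good_def)

text \<open>Every atom has mass at least \<open>lam\<close>. This bounds pointwise values by a mean,
  and a variance from below by a single large deviation.\<close>

lemma good_ex1_point:
  assumes "good P" "x \<in> supp P" "\<And>x. x \<in> supp P \<Longrightarrow> 0 \<le> u x"
  shows "lam * u x \<le> ex1 P u"
proof -
  have "lam * u x \<le> mg P x * u x" using assms good_mg by (intro mult_right_mono) auto
  also have "\<dots> \<le> ex1 P u" using assms by (intro ex1_ge_point good_kern) auto
  finally show ?thesis .
qed

text \<open>Concavity of \<open>z powr k\<close>, in the form of Young's inequality, gives
  \<open>z powr k \<le> 1 + k * (z - 1)\<close>; multiply by \<open>z\<close>.\<close>

lemma powr_le_quadratic:
  fixes z k :: real
  assumes "0 \<le> z" "0 < k" "k \<le> 1"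
  shows "z powr (1 + k) \<le> z + k * ((z - 1) + (z - 1)\<^sup>2)"
proof (cases "z = 0")
  case True then show ?thesis using assms by simp
next
  case False
  then have z: "0 < z" using assms by simp
  have "z powr k \<le> 1 + k * (z - 1)"
  proof (cases "k = 1")
    case True then show ?thesis using z by simp
  next
    case False
    have "z powr k * 1 powr (1 - k) \<le> k * z + (1 - k) * 1"
      using Youngs_inequality_0[of k "1-k" z 1] assms z by simp
    then show ?thesis by (simp add: algebra_simps)
  qed
  then have "z * z powr k \<le> z * (1 + k * (z - 1))"
    using z by (intro mult_left_mono) auto
  also have "\<dots> = z + k * ((z - 1) + (z - 1)\<^sup>2)" by (simp add: power2_eq_square algebra_simps)
  finally show ?thesis using z by (simp add: powr_add)
qed

text \<open>With \<open>R = 1 / sqrt lam + 1\<close> and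
  \<open>(z - 1)\<^sup>2 \<le> R\<^sup>2 * (L * D)\<close>, this value makes the quadratic error
  \<open>hyper_gain * R\<^sup>2 * L * D\<close> equal to \<open>D / 2\<close>, the amount by which
  the mean of \<open>z\<close> falls short of 1.\<close>

definition hyper_gain :: real where
  "hyper_gain = 1 / (2 * L * (1 / sqrt lam + 1)\<^sup>2)"

text \<open>Exponent of \<open>u\<close> and \<open>v\<close> corresponding to the exponent
  \<open>1 + hyper_gain\<close> of the square root \<open>z\<close> of their product; it exceeds
  1/2.\<close>

definition hyper_exp :: real where
  "hyper_exp = (1 + hyper_gain) / 2"

lemma hyper_gain: "0 < hyper_gain" "hyper_gain \<le> 1"
proof -
  have p: "0 < 1 / sqrt lam" using lam by simp
  have "1 \<le> (1 / sqrt lam + 1)\<^sup>2"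
    using power_mono[of 1 "1 / sqrt lam + 1" 2] p by simp
  then have "2 * 1 * 1 \<le> 2 * L * (1 / sqrt lam + 1)\<^sup>2"
    using L by (intro mult_mono) auto
  then show "0 < hyper_gain" "hyper_gain \<le> 1" unfolding hyper_gain_def by auto
qed

text \<open>
  Put \<open>z = sqrt (u X * v Y)\<close>.  Then \<open>E z = 1 - D / 2\<close>, where \<open>D\<close> is the energy of
  \<open>(sqrt u, sqrt v)\<close>; by connectedness \<open>(z - 1)\<^sup>2\<close> is also of order \<open>D\<close>, so the
  exponent of \<open>z\<close> may be raised slightly above 1.
\<close>

lemma hypercontractive_normalized:
  assumes g: "good P" and u: "\<And>x. 0 \<le> u x" and v: "\<And>x. 0 \<le> v x"
    and 1: "ex1 P u = 1" "ex1 P v = 1"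
  shows "ex2 P (\<lambda>x y. (u x * v y) powr hyper_exp) \<le> 1"
proof -
  have k: "kern P" by (rule good_kern[OF g])
  define D where "D = ex2 P (\<lambda>a b. (sqrt (u a) - sqrt (v b))\<^sup>2)"
  define z where "z x y = sqrt (u x) * sqrt (v y)" for x y
  define R where "R = 1 / sqrt lam + 1"
  have D0: "0 \<le> D" unfolding D_def by (intro ex2_nonneg k) auto
  have close: "\<bar>sqrt (u x) - sqrt (v y)\<bar> \<le> sqrt (L * D)" if "x \<in> supp P" "y \<in> supp P" for x y
    using real_sqrt_le_mono[OF good_connected[OF g that, of "\<lambda>a. sqrt (u a)" "\<lambda>b. sqrt (v b)"]]
    by (simp add: D_def)
  \<comment> \<open>Both means are 1, so \<open>u\<close> and \<open>v\<close> each take values on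
    either side of 1. By \<open>close\<close>, the square roots of the other function are then all
    within \<open>sqrt (L * D)\<close> of 1.\<close>
  obtain a a' b b' where ab: "a \<in> supp P" "1 \<le> u a" "a' \<in> supp P" "u a' \<le> 1"
     "b \<in> supp P" "1 \<le> v b" "b' \<in> supp P" "v b' \<le> 1"
    using ex1_exists_ge[OF k, of 1 u] ex1_exists_le[OF k, of u 1]
     ex1_exists_ge[OF k, of 1 v] ex1_exists_le[OF k, of v 1] 1 by auto
  have r: "1 \<le> sqrt (u a)" "sqrt (u a') \<le> 1" "1 \<le> sqrt (v b)" "sqrt (v b') \<le> 1"
    using ab by simp_all
  have u1: "\<bar>sqrt (u x) - 1\<bar> \<le> sqrt (L * D)" if "x \<in> supp P" for x
    using close[OF that ab(5)] close[OF that ab(7)] r(3,4) by linarith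
  have v1: "\<bar>sqrt (v x) - 1\<bar> \<le> sqrt (L * D)" if "x \<in> supp P" for x
    using close[OF ab(1) that] close[OF ab(3) that] r(1,2) by linarith
  have ub: "sqrt (u x) \<le> 1 / sqrt lam" if "x \<in> supp P" for x
  proof -
    have "u x \<le> 1 / lam"
      using good_ex1_point[OF g that, of u] u 1 lam by (simp add: field_simps)
    from real_sqrt_le_mono[OF this] show ?thesis by (simp add: real_sqrt_divide)
  qed
  have z1: "(z x y - 1)\<^sup>2 \<le> R\<^sup>2 * (L * D)" if "x \<in> supp P" "y \<in> supp P" for x y
  proof -
    have "z x y - 1 = sqrt (u x) * (sqrt (v y) - 1) + (sqrt (u x) - 1)"
      by (simp add: z_def algebra_simps)
    then have "\<bar>z x y - 1\<bar> \<le> sqrt (u x) * \<bar>sqrt (v y) - 1\<bar> + \<bar>sqrt (u x) - 1\<bar>"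
      using abs_triangle_ineq[of "sqrt (u x) * (sqrt (v y) - 1)" "sqrt (u x) - 1"] u
      by (simp add: abs_mult)
    also have "\<dots> \<le> (1 / sqrt lam) * sqrt (L * D) + sqrt (L * D)"
      using that u u1 v1 ub lam D0 L by (intro add_mono mult_mono) auto
    also have "\<dots> = R * sqrt (L * D)" by (simp add: R_def algebra_simps)
    finally have "\<bar>z x y - 1\<bar>\<^sup>2 \<le> (R * sqrt (L * D))\<^sup>2" by (intro power_mono) auto
    then show ?thesis using D0 L by (simp add: power_mult_distrib)
  qed
  have zE: "ex2 P z = 1 - D / 2"
  proof -
    have "D = ex2 P (\<lambda>x y. (u x + v y) - 2 * z x y)"
      unfolding D_def z_def using u v
      by (intro arg_cong[of _ _ "ex2 P"] ext) (simp add: power2_diff algebra_simps)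
    also have "\<dots> = 2 - 2 * ex2 P z"
      by (simp only: ex2_diff ex2_add ex2_cmult ex2_fst ex2_snd[OF k] 1)
    finally show ?thesis by linarith
  qed
  have "ex2 P (\<lambda>x y. (u x * v y) powr hyper_exp) = ex2 P (\<lambda>x y. z x y powr (1 + hyper_gain))"
  proof (intro arg_cong[of _ _ "ex2 P"] ext)
    fix x y
    have "z x y = (u x * v y) powr (1/2)" using u v by (simp add: z_def powr_half_sqrt real_sqrt_mult)
    then show "(u x * v y) powr hyper_exp = z x y powr (1 + hyper_gain)" by (simp add: hyper_exp_def powr_powr)
  qed
  also have "\<dots> \<le> ex2 P (\<lambda>x y. z x y + hyper_gain * ((z x y - 1) + R\<^sup>2 * (L * D)))"
  proof (intro ex2_mono k)
    fix x y assume s: "x \<in> supp P" "y \<in> supp P"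
    have "z x y powr (1 + hyper_gain) \<le> z x y + hyper_gain * ((z x y - 1) + (z x y - 1)\<^sup>2)"
      using u v hyper_gain by (intro powr_le_quadratic) (auto simp: z_def)
    also have "\<dots> \<le> z x y + hyper_gain * ((z x y - 1) + R\<^sup>2 * (L * D))"
      using z1[OF s] hyper_gain by (intro add_left_mono mult_left_mono) auto
    finally show "z x y powr (1 + hyper_gain) \<le> z x y + hyper_gain * ((z x y - 1) + R\<^sup>2 * (L * D))" .
  qed
  also have "\<dots> = (1 - D / 2) + hyper_gain * ((1 - D / 2 - 1) + R\<^sup>2 * (L * D))"
    by (simp only: ex2_diff ex2_add ex2_cmult ex2_const[OF k] zE)
  also have "\<dots> \<le> 1"
  proof -
    have "0 < R" using lam by (simp add: R_def add_pos_pos)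
    then have "hyper_gain * (2 * L * R\<^sup>2) = 1" using L by (simp add: hyper_gain_def R_def[symmetric])
    moreover have "(1 - D / 2) + hyper_gain * ((1 - D / 2 - 1) + R\<^sup>2 * (L * D))
        = 1 - D / 2 - hyper_gain * (D / 2) + hyper_gain * (2 * L * R\<^sup>2) * (D / 2)"
      by (simp add: algebra_simps)
    moreover have "0 \<le> hyper_gain * (D / 2)" using D0 hyper_gain by simp
    ultimately show ?thesis by simp
  qed
  finally show ?thesis .
qed

text \<open>In terms of \<open>u powr hyper_exp\<close> and \<open>v powr hyper_exp\<close> this
  bounds a correlation by two norms of exponent \<open>1 / hyper_exp < 2\<close>. Dividing by the
  means reduces it to the normalized case; if a mean is zero, that function vanishes on the
  support.\<close>

lemma hypercontractive:
  assumes g: "good P" and u: "\<And>x. 0 \<le> u x" and v: "\<And>x. 0 \<le> v x"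
  shows "ex2 P (\<lambda>x y. u x powr hyper_exp * v y powr hyper_exp) \<le> ex1 P u powr hyper_exp * ex1 P v powr hyper_exp"
proof -
  have k: "kern P" by (rule good_kern[OF g])
  have n: "0 \<le> ex1 P u" "0 \<le> ex1 P v" using u v by (auto intro!: ex1_nonneg k)
  have z: "w x = 0" if "x \<in> supp P" "\<And>x. 0 \<le> w x" "ex1 P w = 0" for w x
    using good_ex1_point[OF g that(1), of w] that(2)[of x] that(2,3) lam
    by (simp add: mult_le_0_iff)
  consider "ex1 P u = 0" | "ex1 P v = 0" | "0 < ex1 P u" "0 < ex1 P v" using n by linarith
  then show ?thesis
  proof cases
    case 1
    have "ex2 P (\<lambda>x y. u x powr hyper_exp * v y powr hyper_exp) = ex2 P (\<lambda>x y. 0)"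
      using z[of _ u] 1 u by (intro ex2_cong k) auto
    then show ?thesis using 1 by (simp add: ex2_const[OF k])
  next
    case 2
    have "ex2 P (\<lambda>x y. u x powr hyper_exp * v y powr hyper_exp) = ex2 P (\<lambda>x y. 0)"
      using z[of _ v] 2 v by (intro ex2_cong k) auto
    then show ?thesis using 2 by (simp add: ex2_const[OF k])
  next
    case 3
    define a where "a x = (1 / ex1 P u) * u x" for x
    define b where "b x = (1 / ex1 P v) * v x" for x
    have ab: "ex1 P a = 1" "ex1 P b = 1"
      unfolding a_def b_def ex1_cmult using 3 by simp_all
    have nn: "0 \<le> a x" "0 \<le> b x" for x
      using 3 u v by (simp_all add: a_def b_def)
    have "ex2 P (\<lambda>x y. u x powr hyper_exp * v y powr hyper_exp) =
        ex2 P (\<lambda>x y. (ex1 P u powr hyper_exp * ex1 P v powr hyper_exp) * (a x * b y) powr hyper_exp)"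
      using 3 u v by (intro arg_cong[of _ _ "ex2 P"] ext)
        (simp add: a_def b_def powr_mult powr_divide)
    also have "\<dots> = (ex1 P u powr hyper_exp * ex1 P v powr hyper_exp) * ex2 P (\<lambda>x y. (a x * b y) powr hyper_exp)"
      by (rule ex2_cmult)
    also have "\<dots> \<le> (ex1 P u powr hyper_exp * ex1 P v powr hyper_exp) * 1"
      using nn ab by (intro mult_left_mono hypercontractive_normalized g) auto
    finally show ?thesis by simp
  qed
qed

end

section \<open>Conditional means and exchange of the two coordinates\<close>

context alphabet
begin

definition cond_mean :: "('a \<Rightarrow> 'a \<Rightarrow> real) \<Rightarrow> ('a \<Rightarrow> real) \<Rightarrow> 'a \<Rightarrow> real" where
  "cond_mean P h x = (\<Sum>y\<in>A. P x y * h y) / mg P x"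

text \<open>Off the support the quotient is 0 by convention, and the row of \<open>P\<close>
  vanishes too, so no case distinction is left to later uses.\<close>

lemma mg_cond_mean:
  assumes "kern P" "x \<in> A"
  shows "mg P x * cond_mean P h x = (\<Sum>y\<in>A. P x y * h y)"
proof (cases "x \<in> supp P")
  case True then show ?thesis by (simp add: cond_mean_def supp_def)
next
  case False
  then have "(\<Sum>y\<in>A. P x y * h y) = 0" using assms kern_eq_0 by (intro sum.neutral) auto
  then show ?thesis by (simp add: cond_mean_def)
qed

lemma ex2_cond_mean: "kern P \<Longrightarrow> ex2 P (\<lambda>x y. s x * h y) = ex1 P (\<lambda>x. s x * cond_mean P h x)"
proof -
  assume k: "kern P"
  have "(\<Sum>y\<in>A. P x y * (s x * h y)) = mg P x * (s x * cond_mean P h x)" if "x \<in> A" for x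
  proof -
    have "(\<Sum>y\<in>A. P x y * (s x * h y)) = s x * (mg P x * cond_mean P h x)"
      unfolding mg_cond_mean[OF k that] sum_distrib_left by (simp add: algebra_simps)
    then show ?thesis by simp
  qed
  then show ?thesis by (simp add: ex2_def ex1_def)
qed

definition transp :: "('a \<Rightarrow> 'a \<Rightarrow> real) \<Rightarrow> 'a \<Rightarrow> 'a \<Rightarrow> real" where
  "transp P x y = P y x"

lemma ex2_transp: "ex2 (transp P) h = ex2 P (\<lambda>x y. h y x)"
  unfolding ex2_def transp_def by (rule sum.swap)

lemma mg_transp: "kern P \<Longrightarrow> x \<in> A \<Longrightarrow> mg (transp P) x = mg P x"
  by (simp add: kern_def mg_def transp_def)

lemma supp_transp: "kern P \<Longrightarrow> supp (transp P) = supp P"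
  by (auto simp: supp_def mg_transp)

lemma ex1_transp: "kern P \<Longrightarrow> ex1 (transp P) u = ex1 P u"
  by (simp add: ex1_def mg_transp)

lemma kern_transp: "kern P \<Longrightarrow> kern (transp P)"
  unfolding kern_def ex2_transp by (simp add: mg_def transp_def)

end

text \<open>A second order Bernoulli inequality without upper bound on \<open>a\<close>. The
  induction step has the surplus \<open>(a - 1)\<^sup>2 * (n + a - 1)\<close>, which is nonnegative
  as \<open>a - 1 \<ge> -1\<close>.\<close>

lemma power_ge_quadratic:
  fixes a :: real
  assumes "0 \<le> a" "2 \<le> n"
  shows "1 + real n * (a - 1) + (a - 1)\<^sup>2 \<le> a ^ n"
  using assms(2)
proof (induction n rule: dec_induct)
  case base
  then show ?case by (simp add: power2_eq_square algebra_simps)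
next
  case (step n)
  define s where "s = a - 1"
  have s: "a = 1 + s" "-1 \<le> s" using assms(1) by (simp_all add: s_def)
  have "0 \<le> s\<^sup>2 * (real n + s)" using s step(1) by (intro mult_nonneg_nonneg) auto
  then have "1 + real (Suc n) * s + s\<^sup>2 \<le> (1 + s) * (1 + real n * s + s\<^sup>2)"
    by (simp add: power2_eq_square algebra_simps)
  also have "\<dots> \<le> a * a ^ n"
    unfolding s(1)[symmetric] using step(3) assms(1) by (intro mult_left_mono) (simp_all add: s_def)
  finally show ?case by (simp add: s_def)
qed

text \<open>Near 1 almost the full binomial coefficient of the square survives; the factor
  \<open>1 - N * k\<close> leaves room for the cubic term of the induction step.\<close>

lemma power_ge_quadratic_small:
  fixes s k :: real
  assumes "\<bar>s\<bar> \<le> k" "real N * k \<le> 1" "n \<le> N"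
  shows "1 + real n * s + (1 - real N * k) * (real n * (real n - 1) / 2) * s\<^sup>2 \<le> (1 + s) ^ n"
  using assms(3)
proof (induction n)
  case 0
  then show ?case by simp
next
  case (Suc n)
  define d where "d = 1 - real N * k"
  have d: "0 \<le> d" "d \<le> 1" using assms by (auto simp: d_def intro!: mult_nonneg_nonneg)
  have k0: "0 \<le> k" using assms(1) by linarith
  have N1: "1 \<le> real N" using Suc.prems by simp
  have "k \<le> 1"
    using mult_right_mono[OF N1 k0] assms(2) by simp
  then have s1: "0 \<le> 1 + s" using assms(1) by linarith
  have m: "\<bar>(real n - 1) / 2\<bar> \<le> real N" using Suc.prems by (simp add: abs_le_iff)
  have "\<bar>d * ((real n - 1) / 2) * s\<bar> \<le> 1 * real N * k"
    unfolding abs_mult using d m assms(1) by (intro mult_mono) auto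
  then have "- (real N * k) \<le> d * ((real n - 1) / 2) * s" by (simp only: abs_le_iff) linarith
  then have "0 \<le> (1 - d) + d * (real n - 1) / 2 * s" by (simp add: d_def)
  then have "0 \<le> real n * s\<^sup>2 * ((1 - d) + d * (real n - 1) / 2 * s)"
    by (intro mult_nonneg_nonneg) auto
  moreover have "(1 + s) * (1 + z * s + d * (z * (z - 1) / 2) * s\<^sup>2)
      - (1 + (z + 1) * s + d * ((z + 1) * z / 2) * s\<^sup>2) = z * s\<^sup>2 * ((1 - d) + d * ((z - 1) / 2) * s)" for z
    by (simp add: power2_eq_square field_simps)
  from this[of "real n"] have "(1 + s) * (1 + real n * s + d * (real n * (real n - 1) / 2) * s\<^sup>2)
      - (1 + real (Suc n) * s + d * (real (Suc n) * (real (Suc n) - 1) / 2) * s\<^sup>2)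
      = real n * s\<^sup>2 * ((1 - d) + d * ((real n - 1) / 2) * s)"
    by (simp add: add.commute)
  ultimately have "1 + real (Suc n) * s + d * (real (Suc n) * (real (Suc n) - 1) / 2) * s\<^sup>2
      \<le> (1 + s) * (1 + real n * s + d * (real n * (real n - 1) / 2) * s\<^sup>2)"
    by simp
  also have "\<dots> \<le> (1 + s) * (1 + s) ^ n"
    using Suc s1 by (intro mult_left_mono) (auto simp: d_def)
  finally show ?case by (simp add: d_def)
qed

section \<open>Maximal correlation and the submartingale inequality for one coordinate\<close>

context connected_alphabet
begin

lemma good_transp: "good P \<Longrightarrow> good (transp P)"
proof -
  assume g: "good P"
  note k = good_kern[OF g]
  have "(u x - v y)\<^sup>2 \<le> L * ex2 (transp P) (\<lambda>a b. (u a - v b)\<^sup>2)"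
    if "x \<in> supp P" "y \<in> supp P" for u v x y
    using good_connected[OF g that(2,1), of v u] by (simp add: ex2_transp power2_commute)
  then show ?thesis
    using g unfolding good_def by (simp add: kern_transp supp_transp[OF k] transp_def)
qed

text \<open>An upper bound for the maximal correlation of every \<open>good\<close> law, as
  \<open>cond_mean_contraction\<close> shows.\<close>

definition rho :: real where
  "rho = sqrt (L / (L + 1))"

lemma rho: "0 < rho" "rho < 1" "rho\<^sup>2 = L / (L + 1)"
  using L by (auto simp: rho_def real_sqrt_lt_1_iff)

text \<open>Let \<open>T\<close> and \<open>H\<close> be the second moments of the conditional mean
  and of \<open>h\<close>. The energy of this pair is \<open>H - T\<close> by orthogonality.
  Averaging the connectedness bound over independent \<open>x\<close> and \<open>y\<close> gives
  \<open>T + H \<le> L * (H - T)\<close>, as \<open>h\<close> is centred.\<close>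

lemma cond_mean_contraction:
  assumes g: "good P" and h: "ex1 P h = 0"
  shows "ex1 P (\<lambda>x. (cond_mean P h x)\<^sup>2) \<le> rho\<^sup>2 * ex1 P (\<lambda>x. (h x)\<^sup>2)"
proof -
  note k = good_kern[OF g]
  define t where "t = cond_mean P h"
  define T where "T = ex1 P (\<lambda>x. (t x)\<^sup>2)"
  define H where "H = ex1 P (\<lambda>x. (h x)\<^sup>2)"
  define D where "D = ex2 P (\<lambda>a b. (t a - h b)\<^sup>2)"
  have H0: "0 \<le> H" unfolding H_def by (intro ex1_nonneg k) auto
  have "D = ex2 P (\<lambda>a b. ((t a)\<^sup>2 + (h b)\<^sup>2) - 2 * (t a * h b))"
    unfolding D_def by (intro arg_cong[of _ _ "ex2 P"] ext) (simp add: power2_diff)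
  also have "\<dots> = (T + H) - 2 * ex1 P (\<lambda>x. t x * t x)"
    by (simp only: ex2_diff ex2_add ex2_cmult ex2_fst ex2_snd[OF k] T_def H_def ex2_cond_mean[OF k]
        t_def[symmetric])
  finally have D: "D = H - T" by (simp add: T_def power2_eq_square)
  have "ex1 P (\<lambda>x. ex1 P (\<lambda>y. (t x - h y)\<^sup>2)) \<le> ex1 P (\<lambda>x. ex1 P (\<lambda>y. L * D))"
    unfolding D_def by (intro ex1_mono k good_connected[OF g])
  also have "\<dots> = L * D" by (simp add: ex1_const[OF k])
  also have "ex1 P (\<lambda>x. ex1 P (\<lambda>y. (t x - h y)\<^sup>2)) = ex1 P (\<lambda>x. (t x)\<^sup>2 + H)"
  proof (intro arg_cong[of _ _ "ex1 P"] ext)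
    fix x
    have "ex1 P (\<lambda>y. (t x - h y)\<^sup>2) = ex1 P (\<lambda>y. ((t x)\<^sup>2 + (h y)\<^sup>2) - (2 * t x) * h y)"
      by (intro arg_cong[of _ _ "ex1 P"] ext) (simp add: power2_diff)
    also have "\<dots> = (t x)\<^sup>2 + H - 2 * t x * 0"
      by (simp only: ex1_diff ex1_add ex1_cmult ex1_const[OF k] h H_def)
    finally show "ex1 P (\<lambda>y. (t x - h y)\<^sup>2) = (t x)\<^sup>2 + H" by simp
  qed
  also have "\<dots> = T + H"
    by (simp only: ex1_add ex1_const[OF k] T_def)
  finally have "T * (L + 1) \<le> (L - 1) * H" unfolding D by (simp add: algebra_simps)
  also have "\<dots> \<le> L * H" using H0 by (simp add: algebra_simps)
  finally have "T \<le> L / (L + 1) * H" using L by (simp add: field_simps)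
  then show ?thesis by (simp add: rho T_def H_def t_def)
qed

text \<open>Replace \<open>t\<close> by its conditional mean and complete the square with weight
  \<open>rho\<close>; the contraction by \<open>rho\<^sup>2\<close> then balances both
  terms.\<close>

lemma correlation:
  assumes g: "good P" and t: "ex1 P t = 0"
  shows "- (rho / 2) * (ex1 P (\<lambda>x. (s x)\<^sup>2) + ex1 P (\<lambda>x. (t x)\<^sup>2)) \<le> ex2 P (\<lambda>x y. s x * t y)"
proof -
  note k = good_kern[OF g]
  have "- (rho / 2) * (ex1 P (\<lambda>x. (s x)\<^sup>2) + ex1 P (\<lambda>x. (t x)\<^sup>2))
     \<le> - (rho / 2) * ex1 P (\<lambda>x. (s x)\<^sup>2) + (- 1 / (2 * rho)) * ex1 P (\<lambda>x. (cond_mean P t x)\<^sup>2)"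
    using cond_mean_contraction[OF g t] rho(1) by (simp add: field_simps power2_eq_square)
  also have "\<dots> = ex1 P (\<lambda>x. - (rho / 2) * (s x)\<^sup>2 + (- 1 / (2 * rho)) * (cond_mean P t x)\<^sup>2)"
    by (simp only: ex1_add ex1_cmult)
  also have "\<dots> \<le> ex1 P (\<lambda>x. s x * cond_mean P t x)"
  proof (intro ex1_mono k)
    fix x
    have "0 \<le> (rho * s x + cond_mean P t x)\<^sup>2 / (2 * rho)" using rho by simp
    also have "\<dots> = s x * cond_mean P t x - (- (rho / 2) * (s x)\<^sup>2 + (- 1 / (2 * rho)) * (cond_mean P t x)\<^sup>2)"
      using rho(1) by (simp add: power2_eq_square field_simps)
    finally show "- (rho / 2) * (s x)\<^sup>2 + (- 1 / (2 * rho)) * (cond_mean P t x)\<^sup>2 \<le> s x * cond_mean P t x" by simp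
  qed
  also have "\<dots> = ex2 P (\<lambda>x y. s x * t y)" by (simp add: ex2_cond_mean[OF k])
  finally show ?thesis .
qed

text \<open>The exponent called \<open>C\<close> in the overview. It is large enough for
  \<open>C * rho \<le> C - 2\<close>, so that the quadratic terms outweigh the correlation
  term.\<close>

definition sub_exp :: nat where
  "sub_exp = nat \<lceil>2 / (1 - rho)\<rceil>"

text \<open>Range of the second order expansion, chosen so that its loss
  \<open>sub_exp * small_dev\<close> is only \<open>1 / (2 * sub_exp)\<close>.\<close>

definition small_dev :: real where
  "small_dev = 1 / (2 * (real sub_exp)\<^sup>2)"

text \<open>A deviation beyond \<open>small_dev\<close> creates variance at least
  \<open>V = lam * small_dev\<^sup>2\<close>; a factor within \<open>tiny_dev\<close> of 1 loses at
  most \<open>V / 2\<close> when raised to the power \<open>sub_exp\<close>.\<close>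

definition tiny_dev :: real where
  "tiny_dev = lam * small_dev\<^sup>2 / (2 * real sub_exp)"

lemma sub_exp: "2 \<le> sub_exp" "2 \<le> real sub_exp * (1 - rho)"
proof -
  have "2 / (1 - rho) \<le> real sub_exp" unfolding sub_exp_def by (rule real_nat_ceiling_ge)
  then show *: "2 \<le> real sub_exp * (1 - rho)" using rho by (simp add: field_simps)
  have "real sub_exp * (1 - rho) \<le> real sub_exp * 1" using rho by (intro mult_left_mono) auto
  then show "2 \<le> sub_exp" using * by linarith
qed

lemma small_dev: "0 < small_dev" "small_dev \<le> 1" "real sub_exp * small_dev = 1 / (2 * real sub_exp)" "real sub_exp * small_dev \<le> 1"
proof -
  show "0 < small_dev" using sub_exp by (simp add: small_dev_def)
  show *: "real sub_exp * small_dev = 1 / (2 * real sub_exp)" using sub_exp by (simp add: small_dev_def power2_eq_square)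
  show **: "real sub_exp * small_dev \<le> 1" unfolding * using sub_exp by (simp add: field_simps)
  show "small_dev \<le> 1"
    using mult_right_mono[of 1 "real sub_exp" small_dev] ** sub_exp(1) \<open>0 < small_dev\<close> by linarith
qed

lemma tiny_dev: "0 < tiny_dev" "tiny_dev \<le> small_dev" "real sub_exp * tiny_dev = lam * small_dev\<^sup>2 / 2" "lam * small_dev\<^sup>2 \<le> 1"
proof -
  have *: "lam * small_dev\<^sup>2 \<le> 1 * small_dev"
    using lam small_dev by (intro mult_mono) (auto simp: power2_eq_square mult_left_le)
  show "0 < tiny_dev" using lam small_dev sub_exp by (simp add: tiny_dev_def)
  have "tiny_dev \<le> lam * small_dev\<^sup>2 / 1"
    unfolding tiny_dev_def using lam sub_exp by (intro divide_left_mono) auto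
  then show "tiny_dev \<le> small_dev" using * by simp
  show "real sub_exp * tiny_dev = lam * small_dev\<^sup>2 / 2" using sub_exp by (simp add: tiny_dev_def)
  show "lam * small_dev\<^sup>2 \<le> 1" using * small_dev by simp
qed

text \<open>
  If \<open>a\<close> is close to 1 as well, second order expansion applies, and the mixed term is absorbed
  by the quadratic ones because the correlation is \<open>rho < 1\<close>.  Otherwise the gain from the
  variance of \<open>a\<close> outweighs the fluctuation of \<open>b\<close>.
\<close>

lemma submartingale_normalized:
  assumes g: "good P" and a: "\<And>x. 0 \<le> a x" and b: "\<And>x. 0 \<le> b x"
    and 1: "ex1 P a = 1" "ex1 P b = 1"
    and small: "\<And>x. x \<in> supp P \<Longrightarrow> \<bar>b x - 1\<bar> \<le> tiny_dev"
  shows "1 \<le> ex2 P (\<lambda>x y. a x ^ sub_exp * b y ^ sub_exp)"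
proof (cases "\<forall>x\<in>supp P. \<bar>a x - 1\<bar> \<le> small_dev")
  case False
  note k = good_kern[OF g]
  then obtain x0 where x0: "x0 \<in> supp P" "small_dev \<le> \<bar>a x0 - 1\<bar>" using False by force
  define V where "V = lam * small_dev\<^sup>2"
  have V: "0 \<le> V" "V \<le> 1" using lam tiny_dev by (auto simp: V_def)
  have "V \<le> lam * (a x0 - 1)\<^sup>2"
    unfolding V_def using x0 small_dev lam by (intro mult_left_mono) (auto simp: abs_le_square_iff[symmetric])
  also have "\<dots> \<le> ex1 P (\<lambda>x. (a x - 1)\<^sup>2)" by (intro good_ex1_point[OF g] x0) auto
  finally have "1 + V \<le> 1 + real sub_exp * (1 - 1) + ex1 P (\<lambda>x. (a x - 1)\<^sup>2)" by simp
  also have "\<dots> = ex1 P (\<lambda>x. 1 + real sub_exp * (a x - 1) + (a x - 1)\<^sup>2)"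
    by (simp only: ex1_add ex1_cmult ex1_diff ex1_const[OF k] 1)
  also have "\<dots> \<le> ex1 P (\<lambda>x. a x ^ sub_exp)"
    using a sub_exp by (intro ex1_mono k power_ge_quadratic)
  finally have aV: "1 + V \<le> ex1 P (\<lambda>x. a x ^ sub_exp)" .
  have "0 \<le> V * (1 - V) / 2" using V by simp
  then have "1 \<le> (1 - V / 2) * (1 + V)" by (simp add: algebra_simps)
  also have "\<dots> \<le> (1 - V / 2) * ex1 P (\<lambda>x. a x ^ sub_exp)" using aV V by (intro mult_left_mono) auto
  also have "\<dots> = ex2 P (\<lambda>x y. (1 - V / 2) * a x ^ sub_exp)" by (simp only: ex2_cmult ex2_fst)
  also have "\<dots> \<le> ex2 P (\<lambda>x y. a x ^ sub_exp * b y ^ sub_exp)"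
  proof (intro ex2_mono k)
    fix x y assume y: "y \<in> supp P"
    have "1 - V / 2 = 1 + real sub_exp * (- tiny_dev)" using tiny_dev(3) by (simp add: V_def)
    also have "\<dots> \<le> (1 + - tiny_dev) ^ sub_exp" using tiny_dev small_dev by (intro Bernoulli_inequality) auto
    also have "\<dots> \<le> b y ^ sub_exp" using small[OF y] tiny_dev small_dev by (intro power_mono) auto
    finally show "(1 - V / 2) * a x ^ sub_exp \<le> a x ^ sub_exp * b y ^ sub_exp"
      using a by (simp add: mult.commute mult_left_mono)
  qed
  finally show ?thesis .
next
  case True
  note k = good_kern[OF g]
  define c where "c = real sub_exp"
  define e where "e = 1 - c * small_dev"
  define D where "D = e * (c * (c - 1) / 2)"
  define s where "s = (\<lambda>x. a x - 1)"
  define t where "t = (\<lambda>x. b x - 1)"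
  define W where "W = ex1 P (\<lambda>x. (s x)\<^sup>2) + ex1 P (\<lambda>x. (t x)\<^sup>2)"
  have st0: "ex1 P s = 0" "ex1 P t = 0" by (simp_all add: s_def t_def ex1_diff ex1_const[OF k] 1)
  have W0: "0 \<le> W" unfolding W_def by (intro add_nonneg_nonneg ex1_nonneg k) auto
  have c2: "2 \<le> c" using sub_exp by (simp add: c_def)
  have e0: "0 \<le> e" using small_dev by (simp add: e_def c_def)
  have D0: "0 \<le> D" using e0 c2 by (simp add: D_def)
  \<comment> \<open>The correlation term costs at most \<open>c\<^sup>2 * (rho / 2)\<close> times
    \<open>W\<close>, and the squares contribute \<open>D * e\<close> times
    \<open>W\<close>.\<close>
  have key: "c\<^sup>2 * (rho / 2) \<le> D * e"
  proof -
    have e': "e = 1 - 1 / (2 * c)" using small_dev(3) by (simp add: e_def c_def)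
    have "1 - 1 / c \<le> e\<^sup>2" unfolding e' using c2 by (simp add: power2_eq_square field_simps)
    then have "(1 - 1 / c) * (c - 1) \<le> e\<^sup>2 * (c - 1)" using c2 by (intro mult_right_mono) auto
    moreover have "c - 2 \<le> (1 - 1 / c) * (c - 1)" using c2 by (simp add: field_simps)
    moreover have "c * rho \<le> c - 2" using sub_exp(2) by (simp add: c_def algebra_simps)
    ultimately have "c * rho \<le> e\<^sup>2 * (c - 1)" by linarith
    then have "c / 2 * (c * rho) \<le> c / 2 * (e\<^sup>2 * (c - 1))" using c2 by (intro mult_left_mono) auto
    then show ?thesis by (simp add: D_def power2_eq_square algebra_simps)
  qed
  have "1 \<le> 1 + (D * e - c\<^sup>2 * (rho / 2)) * W" using key W0 by simp
  also have "\<dots> \<le> 1 + c\<^sup>2 * ex2 P (\<lambda>x y. s x * t y) + D * e * W"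
    using mult_left_mono[OF correlation[OF g st0(2), of s, folded W_def], of "c\<^sup>2"]
    by (simp add: algebra_simps)
  also have "\<dots> = ex2 P (\<lambda>x y. 1 + c * s x + c * t y + c\<^sup>2 * (s x * t y) + D * e * ((s x)\<^sup>2 + (t y)\<^sup>2))"
    by (simp only: ex2_add ex2_cmult ex2_fst ex2_snd[OF k] ex2_const[OF k] ex1_const[OF k] st0 W_def)
  also have "\<dots> \<le> ex2 P (\<lambda>x y. a x ^ sub_exp * b y ^ sub_exp)"
  proof (intro ex2_mono k)
    fix x y assume xy: "x \<in> supp P" "y \<in> supp P"
    have sk: "\<bar>s x\<bar> \<le> small_dev" using True xy by (simp add: s_def)
    have tk: "\<bar>t y\<bar> \<le> small_dev" using small[OF xy(2)] tiny_dev by (simp add: t_def)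
    have "1 + c * s x + D * (s x)\<^sup>2 \<le> (1 + s x) ^ sub_exp"
      using power_ge_quadratic_small[OF sk small_dev(4), of sub_exp] by (simp add: D_def e_def c_def)
    moreover have "1 + c * t y + D * (t y)\<^sup>2 \<le> (1 + t y) ^ sub_exp"
      using power_ge_quadratic_small[OF tk small_dev(4), of sub_exp] by (simp add: D_def e_def c_def)
    moreover have pos: "0 \<le> 1 + c * z + D * z\<^sup>2" if "\<bar>z\<bar> \<le> small_dev" for z
    proof -
      have "\<bar>c * z\<bar> \<le> c * small_dev" using that c2 by (simp add: abs_mult mult_left_mono)
      then have "0 \<le> 1 + c * z" using small_dev(4) by (simp add: c_def)
      then show ?thesis using D0 by simp
    qed
    ultimately have "(1 + c * s x + D * (s x)\<^sup>2) * (1 + c * t y + D * (t y)\<^sup>2)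
        \<le> (1 + s x) ^ sub_exp * (1 + t y) ^ sub_exp"
      using sk tk a by (intro mult_mono) (auto simp: s_def)
    moreover have "1 + c * s x + c * t y + c\<^sup>2 * (s x * t y) + D * e * ((s x)\<^sup>2 + (t y)\<^sup>2)
        \<le> (1 + c * s x + D * (s x)\<^sup>2) * (1 + c * t y + D * (t y)\<^sup>2)"
    proof -
      have h0: "0 \<le> small_dev + t y" "0 \<le> small_dev + s x" using sk tk by linarith+
      \<comment> \<open>This is the difference of the two sides. The cubic terms of the product are
        absorbed using \<open>s, t \<ge> - small_dev\<close>, which lowers the coefficient of the
        squares from \<open>D\<close> to \<open>D * e\<close>.\<close>
      have "0 \<le> c * D * ((s x)\<^sup>2 * (small_dev + t y) + (t y)\<^sup>2 * (small_dev + s x)) + D\<^sup>2 * ((s x)\<^sup>2 * (t y)\<^sup>2)"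
        using mult_nonneg_nonneg[OF zero_le_power2[of "s x"] h0(1)]
          mult_nonneg_nonneg[OF zero_le_power2[of "t y"] h0(2)] c2 D0
        by (intro add_nonneg_nonneg[of "c * D * _"] mult_nonneg_nonneg[of "c * D"]) simp_all
      then show ?thesis by (simp add: e_def power2_eq_square algebra_simps)
    qed
    ultimately show "1 + c * s x + c * t y + c\<^sup>2 * (s x * t y) + D * e * ((s x)\<^sup>2 + (t y)\<^sup>2)
        \<le> a x ^ sub_exp * b y ^ sub_exp"
      by (simp add: s_def t_def)
  qed
  finally show ?thesis .
qed

text \<open>Division by the means gives the normalized case. The lower bound \<theta> carries over
  to the means and turns the absolute deviation \<open>tiny_dev * \<theta>\<close> into a relative
  one.\<close>

lemma submartingale_right:
  assumes g: "good P" and \<theta>: "0 < \<theta>" and u: "\<And>x. \<theta> \<le> u x" and v: "\<And>x. \<theta> \<le> v x"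
    and small: "\<And>x. x \<in> supp P \<Longrightarrow> \<bar>v x - ex1 P v\<bar> \<le> tiny_dev * \<theta>"
  shows "ex1 P u ^ sub_exp * ex1 P v ^ sub_exp \<le> ex2 P (\<lambda>x y. u x ^ sub_exp * v y ^ sub_exp)"
proof -
  note k = good_kern[OF g]
  have m: "\<theta> \<le> ex1 P u" "\<theta> \<le> ex1 P v"
    using ex1_mono[OF k, of "\<lambda>_. \<theta>"] u v by (simp_all add: ex1_const[OF k])
  then have p: "0 < ex1 P u" "0 < ex1 P v" using \<theta> by auto
  define a where "a x = (1 / ex1 P u) * u x" for x
  define b where "b x = (1 / ex1 P v) * v x" for x
  have ab: "ex1 P a = 1" "ex1 P b = 1"
    unfolding a_def b_def ex1_cmult using p by simp_all
  have nn: "0 \<le> a x" "0 \<le> b x" for x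
    using p order_trans[OF less_imp_le[OF \<theta>] u[of x]] order_trans[OF less_imp_le[OF \<theta>] v[of x]]
    by (simp_all add: a_def b_def)
  have sm: "\<bar>b x - 1\<bar> \<le> tiny_dev" if "x \<in> supp P" for x
  proof -
    have "\<bar>v x - ex1 P v\<bar> \<le> tiny_dev * ex1 P v"
      using small[OF that] m(2) tiny_dev by (meson less_imp_le mult_left_mono order_trans)
    moreover have "b x - 1 = (v x - ex1 P v) / ex1 P v" using p by (simp add: b_def field_simps)
    ultimately show ?thesis using p by (simp add: abs_divide pos_divide_le_eq)
  qed
  have "ex1 P u ^ sub_exp * ex1 P v ^ sub_exp * 1 \<le>
      (ex1 P u ^ sub_exp * ex1 P v ^ sub_exp) * ex2 P (\<lambda>x y. a x ^ sub_exp * b y ^ sub_exp)"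
    using p by (intro mult_left_mono submartingale_normalized g nn ab sm) auto
  also have "\<dots> = ex2 P (\<lambda>x y. (ex1 P u ^ sub_exp * ex1 P v ^ sub_exp) * (a x ^ sub_exp * b y ^ sub_exp))"
    by (simp only: ex2_cmult)
  also have "\<dots> = ex2 P (\<lambda>x y. u x ^ sub_exp * v y ^ sub_exp)"
    using p by (intro arg_cong[of _ _ "ex2 P"] ext) (simp add: a_def b_def power_divide)
  finally show ?thesis by simp
qed

lemma submartingale:
  assumes g: "good P" and \<theta>: "0 < \<theta>" and u: "\<And>x. \<theta> \<le> u x" and v: "\<And>x. \<theta> \<le> v x"
    and small: "(\<forall>x\<in>supp P. \<bar>u x - ex1 P u\<bar> \<le> tiny_dev * \<theta>) \<or> (\<forall>x\<in>supp P. \<bar>v x - ex1 P v\<bar> \<le> tiny_dev * \<theta>)"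
  shows "ex1 P u ^ sub_exp * ex1 P v ^ sub_exp \<le> ex2 P (\<lambda>x y. u x ^ sub_exp * v y ^ sub_exp)"
  using small
proof
  assume "\<forall>x\<in>supp P. \<bar>v x - ex1 P v\<bar> \<le> tiny_dev * \<theta>"
  then show ?thesis by (intro submartingale_right[OF g \<theta> u v]) auto
next
  assume *: "\<forall>x\<in>supp P. \<bar>u x - ex1 P u\<bar> \<le> tiny_dev * \<theta>"
  note k = good_kern[OF g]
  have "ex1 P v ^ sub_exp * ex1 P u ^ sub_exp \<le> ex2 (transp P) (\<lambda>x y. v x ^ sub_exp * u y ^ sub_exp)"
    using submartingale_right[OF good_transp[OF g] \<theta> v u] *
    by (simp add: supp_transp[OF k] ex1_transp[OF k])
  then show ?thesis by (simp add: ex2_transp mult.commute)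
qed

end

section \<open>Conflicts along a product space\<close>

context alphabet
begin

text \<open>
  The coordinates may have different pair laws: they arise by conditioning on the connected
  component of each coordinate.
\<close>

primrec E1 :: "('a \<Rightarrow> 'a \<Rightarrow> real) list \<Rightarrow> ('a list \<Rightarrow> real) \<Rightarrow> real" where
  "E1 [] f = f []"
| "E1 (P # Ps) f = ex1 P (\<lambda>x. E1 Ps (\<lambda>xs. f (x # xs)))"

primrec E2 :: "('a \<Rightarrow> 'a \<Rightarrow> real) list \<Rightarrow> ('a list \<Rightarrow> 'a list \<Rightarrow> real) \<Rightarrow> real" where
  "E2 [] h = h [] []"
| "E2 (P # Ps) h = ex2 P (\<lambda>x y. E2 Ps (\<lambda>xs ys. h (x # xs) (y # ys)))"

lemma E1_add: "E1 Ps (\<lambda>xs. f xs + g xs) = E1 Ps f + E1 Ps g"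
  by (induction Ps arbitrary: f g) (simp_all add: ex1_add)

lemma E1_diff: "E1 Ps (\<lambda>xs. f xs - g xs) = E1 Ps f - E1 Ps g"
  by (induction Ps arbitrary: f g) (simp_all add: ex1_diff)

lemma E1_cmult: "E1 Ps (\<lambda>xs. c * f xs) = c * E1 Ps f"
  by (induction Ps arbitrary: f) (simp_all add: ex1_cmult)

lemma E1_sum: "E1 Ps (\<lambda>xs. \<Sum>i\<in>I. f i xs) = (\<Sum>i\<in>I. E1 Ps (f i))"
  by (induction Ps arbitrary: f) (simp_all add: ex1_sum)

lemma E1_ex1: "E1 Ps (\<lambda>xs. ex1 P (\<lambda>x. f x xs)) = ex1 P (\<lambda>x. E1 Ps (f x))"
  by (simp add: ex1_def E1_sum E1_cmult)

lemma E1_const: "list_all kern Ps \<Longrightarrow> E1 Ps (\<lambda>xs. c) = c"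
  by (induction Ps) (simp_all add: ex1_const)

lemma E1_mono: "list_all kern Ps \<Longrightarrow> (\<And>xs. f xs \<le> g xs) \<Longrightarrow> E1 Ps f \<le> E1 Ps g"
  by (induction Ps arbitrary: f g) (auto intro!: ex1_mono)

lemma E1_nonneg: "list_all kern Ps \<Longrightarrow> (\<And>xs. 0 \<le> f xs) \<Longrightarrow> 0 \<le> E1 Ps f"
  using E1_mono[of Ps "\<lambda>_. 0" f] by (simp add: E1_const)

lemma E1_le_const: "list_all kern Ps \<Longrightarrow> (\<And>xs. f xs \<le> c) \<Longrightarrow> E1 Ps f \<le> c"
  using E1_mono[of Ps f "\<lambda>_. c"] by (simp add: E1_const)

lemma E1_ge_const: "list_all kern Ps \<Longrightarrow> (\<And>xs. c \<le> f xs) \<Longrightarrow> c \<le> E1 Ps f"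
  using E1_mono[of Ps "\<lambda>_. c" f] by (simp add: E1_const)

lemma E1_square_le: "list_all kern Ps \<Longrightarrow> (E1 Ps f)\<^sup>2 \<le> E1 Ps (\<lambda>xs. (f xs)\<^sup>2)"
proof -
  assume k: "list_all kern Ps"
  define m where "m = E1 Ps f"
  have "0 \<le> E1 Ps (\<lambda>xs. (f xs - m)\<^sup>2)" using k by (intro E1_nonneg) auto
  also have "\<dots> = E1 Ps (\<lambda>xs. ((f xs)\<^sup>2 + m\<^sup>2) - (2 * m) * f xs)"
    by (intro arg_cong[of _ _ "E1 Ps"] ext) (simp add: power2_diff)
  also have "\<dots> = E1 Ps (\<lambda>xs. (f xs)\<^sup>2) + m\<^sup>2 - 2 * m * m"
    by (simp only: E1_diff E1_add E1_cmult E1_const[OF k] m_def)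
  finally show ?thesis by (simp add: m_def power2_eq_square)
qed

lemma E2_add: "E2 Ps (\<lambda>xs ys. g xs ys + h xs ys) = E2 Ps g + E2 Ps h"
  by (induction Ps arbitrary: g h) (simp_all add: ex2_add)

lemma E2_cmult: "E2 Ps (\<lambda>xs ys. c * h xs ys) = c * E2 Ps h"
  by (induction Ps arbitrary: h) (simp_all add: ex2_cmult)

lemma E2_sum: "E2 Ps (\<lambda>xs ys. \<Sum>i\<in>I. h i xs ys) = (\<Sum>i\<in>I. E2 Ps (h i))"
  by (induction Ps arbitrary: h) (simp_all add: ex2_sum)

lemma E2_ex2: "E2 Ps (\<lambda>xs ys. ex2 P (\<lambda>x y. h x y xs ys)) = ex2 P (\<lambda>x y. E2 Ps (h x y))"
  by (simp add: ex2_def E2_sum E2_cmult)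

lemma E2_mono: "list_all kern Ps \<Longrightarrow> (\<And>xs ys. g xs ys \<le> h xs ys) \<Longrightarrow> E2 Ps g \<le> E2 Ps h"
  by (induction Ps arbitrary: g h) (auto intro!: ex2_mono)

lemma E2_const: "list_all kern Ps \<Longrightarrow> E2 Ps (\<lambda>xs ys. c) = c"
  by (induction Ps) (simp_all add: ex2_const)

lemma E2_nonneg: "list_all kern Ps \<Longrightarrow> (\<And>xs ys. 0 \<le> h xs ys) \<Longrightarrow> 0 \<le> E2 Ps h"
  using E2_mono[of Ps "\<lambda>_ _. 0" h] by (simp add: E2_const)

lemma E2_fst: "E2 Ps (\<lambda>xs ys. f xs) = E1 Ps f"
  by (induction Ps arbitrary: f) (simp_all add: ex2_fst)

text \<open>Influence of coordinate \<open>i\<close>: the variance in that coordinate with all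
  others fixed, averaged over the others.\<close>

fun infl :: "('a \<Rightarrow> 'a \<Rightarrow> real) list \<Rightarrow> nat \<Rightarrow> ('a list \<Rightarrow> real) \<Rightarrow> real" where
  "infl [] i f = 0"
| "infl (P # Ps) 0 f = E1 Ps (\<lambda>xs. ex1 P (\<lambda>x. (f (x # xs))\<^sup>2) - (ex1 P (\<lambda>x. f (x # xs)))\<^sup>2)"
| "infl (P # Ps) (Suc i) f = ex1 P (\<lambda>x. infl Ps i (\<lambda>xs. f (x # xs)))"

text \<open>
  The first coordinate is bad if revealing it can move the mean by more than \<open>e\<close>; \<open>bad_prob e Ps i f\<close>
  is the probability that coordinate \<open>i\<close> is bad once the earlier ones are revealed.
\<close>

definition bad :: "real \<Rightarrow> ('a \<Rightarrow> 'a \<Rightarrow> real) \<Rightarrow> ('a \<Rightarrow> 'a \<Rightarrow> real) list \<Rightarrow> ('a list \<Rightarrow> real) \<Rightarrow> bool" where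
  "bad e P Ps f \<longleftrightarrow> (\<exists>x\<in>supp P. e < \<bar>E1 Ps (\<lambda>xs. f (x # xs)) - E1 (P # Ps) f\<bar>)"

fun bad_prob :: "real \<Rightarrow> ('a \<Rightarrow> 'a \<Rightarrow> real) list \<Rightarrow> nat \<Rightarrow> ('a list \<Rightarrow> real) \<Rightarrow> real" where
  "bad_prob e [] i f = 0"
| "bad_prob e (P # Ps) 0 f = of_bool (bad e P Ps f)"
| "bad_prob e (P # Ps) (Suc i) f = ex1 P (\<lambda>x. bad_prob e Ps i (\<lambda>xs. f (x # xs)))"

text \<open>Probability of a conflict at step \<open>i\<close>: \<open>f\<close> is read along the
  first components, \<open>g\<close> along the second ones.\<close>

fun both_bad_prob :: "real \<Rightarrow> ('a \<Rightarrow> 'a \<Rightarrow> real) list \<Rightarrow> nat \<Rightarrow> ('a list \<Rightarrow> real) \<Rightarrow> ('a list \<Rightarrow> real) \<Rightarrow> real" where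
  "both_bad_prob e [] i f g = 0"
| "both_bad_prob e (P # Ps) 0 f g = of_bool (bad e P Ps f \<and> bad e P Ps g)"
| "both_bad_prob e (P # Ps) (Suc i) f g =
     ex2 P (\<lambda>x y. both_bad_prob e Ps i (\<lambda>xs. f (x # xs)) (\<lambda>ys. g (y # ys)))"

lemma bad_prob_nonneg: "list_all kern Ps \<Longrightarrow> 0 \<le> bad_prob e Ps i f"
  by (induction e Ps i f rule: bad_prob.induct) (auto intro!: ex1_nonneg)

end

context connected_alphabet
begin

lemma list_good_kern: "list_all good Ps \<Longrightarrow> list_all kern Ps"
  by (induction Ps) (auto simp: good_kern)

text \<open>Reveal the coordinates in order. If one side is not bad, \<open>submartingale\<close>
  applies. In a conflict the product of means, at most 1 since values lie in the unit interval, is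
  given up and charged to \<open>both_bad_prob\<close>.\<close>

lemma E2_submartingale:
  assumes "list_all good Ps" "0 < \<theta>" "\<And>xs. \<theta> \<le> f xs" "\<And>xs. \<theta> \<le> g xs"
    "\<And>xs. f xs \<le> 1" "\<And>xs. g xs \<le> 1"
  shows "E1 Ps f ^ sub_exp * E1 Ps g ^ sub_exp - (\<Sum>i<length Ps. both_bad_prob (tiny_dev * \<theta>) Ps i f g)
    \<le> E2 Ps (\<lambda>xs ys. f xs ^ sub_exp * g ys ^ sub_exp)"
  using assms
proof (induction Ps arbitrary: f g)
  case Nil
  then show ?case by simp
next
  case (Cons P Ps)
  define e where "e = tiny_dev * \<theta>"
  define u where "u = (\<lambda>x. E1 Ps (\<lambda>xs. f (x # xs)))"
  define v where "v = (\<lambda>y. E1 Ps (\<lambda>ys. g (y # ys)))"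
  define S where
    "S = (\<lambda>x y. \<Sum>i<length Ps. both_bad_prob e Ps i (\<lambda>xs. f (x # xs)) (\<lambda>ys. g (y # ys)))"
  have g: "good P" and gs: "list_all good Ps" using Cons.prems by simp_all
  have k: "kern P" and ks: "list_all kern Ps" using g gs good_kern list_good_kern by auto
  have uv: "\<theta> \<le> u x" "u x \<le> 1" "\<theta> \<le> v x" "v x \<le> 1" for x
    unfolding u_def v_def using Cons.prems by (auto intro!: E1_ge_const E1_le_const ks)
  have step: "u x ^ sub_exp * v y ^ sub_exp - S x y \<le> E2 Ps (\<lambda>xs ys. f (x # xs) ^ sub_exp * g (y # ys) ^ sub_exp)" for x y
    unfolding u_def v_def S_def e_def using Cons.prems by (intro Cons.IH) auto
  have m: "E1 (P # Ps) f = ex1 P u" "E1 (P # Ps) g = ex1 P v" by (simp_all add: u_def v_def)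
  have 1: "ex1 P u ^ sub_exp * ex1 P v ^ sub_exp - of_bool (bad e P Ps f \<and> bad e P Ps g)
      \<le> ex2 P (\<lambda>x y. u x ^ sub_exp * v y ^ sub_exp)"
  proof (cases "bad e P Ps f \<and> bad e P Ps g")
    case True
    have "0 \<le> ex1 P u" "ex1 P u \<le> 1" "0 \<le> ex1 P v" "ex1 P v \<le> 1"
      using ex1_mono[OF k, of u "\<lambda>_. 1"] ex1_mono[OF k, of v "\<lambda>_. 1"]
        ex1_mono[OF k, of "\<lambda>_. \<theta>" u] ex1_mono[OF k, of "\<lambda>_. \<theta>" v] uv Cons.prems(2)
      by (auto simp: ex1_const[OF k])
    then have "ex1 P u ^ sub_exp * ex1 P v ^ sub_exp \<le> 1" by (intro mult_le_one power_le_one) auto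
    moreover have "0 \<le> ex2 P (\<lambda>x y. u x ^ sub_exp * v y ^ sub_exp)"
    proof (intro ex2_nonneg k)
      fix x y
      show "0 \<le> u x ^ sub_exp * v y ^ sub_exp"
        using uv(1)[of x] uv(3)[of y] Cons.prems(2) by simp
    qed
    ultimately show ?thesis using True by simp
  next
    case False
    then have "(\<forall>x\<in>supp P. \<bar>u x - ex1 P u\<bar> \<le> e) \<or> (\<forall>x\<in>supp P. \<bar>v x - ex1 P v\<bar> \<le> e)"
      unfolding bad_def m u_def[symmetric] v_def[symmetric]
      by (simp add: u_def v_def not_less)
    then have "ex1 P u ^ sub_exp * ex1 P v ^ sub_exp \<le> ex2 P (\<lambda>x y. u x ^ sub_exp * v y ^ sub_exp)"
      by (intro submartingale[OF g Cons.prems(2) uv(1) uv(3)]) (simp add: e_def)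
    then show ?thesis using False by auto
  qed
  have "(\<Sum>i<length (P # Ps). both_bad_prob e (P # Ps) i f g)
     = of_bool (bad e P Ps f \<and> bad e P Ps g) + ex2 P S"
    by (simp add: sum.lessThan_Suc_shift S_def ex2_sum[symmetric] del: sum.lessThan_Suc)
  then have "E1 (P # Ps) f ^ sub_exp * E1 (P # Ps) g ^ sub_exp - (\<Sum>i<length (P # Ps). both_bad_prob e (P # Ps) i f g)
      \<le> ex2 P (\<lambda>x y. u x ^ sub_exp * v y ^ sub_exp) - ex2 P S"
    using 1 unfolding m by linarith
  also have "\<dots> = ex2 P (\<lambda>x y. u x ^ sub_exp * v y ^ sub_exp - S x y)" by (simp add: ex2_diff)
  also have "\<dots> \<le> E2 (P # Ps) (\<lambda>xs ys. f xs ^ sub_exp * g ys ^ sub_exp)"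
    using step by (auto intro!: ex2_mono k)
  finally show ?case by (simp only: e_def)
qed

text \<open>The hypercontractive inequality tensorizes: apply it to each revealed coordinate in
  turn. At step \<open>i\<close> itself the quantities are indicators, which equal their
  powers.\<close>

lemma both_bad_prob_le:
  "list_all good Ps \<Longrightarrow> both_bad_prob e Ps i f g \<le> bad_prob e Ps i f powr hyper_exp * bad_prob e Ps i g powr hyper_exp"
proof (induction e Ps i f g rule: both_bad_prob.induct)
  case (3 e P Ps i f g)
  then have k: "kern P" "list_all kern Ps" using good_kern list_good_kern by auto
  have "both_bad_prob e (P # Ps) (Suc i) f g \<le> ex2 P (\<lambda>x y. bad_prob e Ps i (\<lambda>xs. f (x # xs)) powr hyper_exp
      * bad_prob e Ps i (\<lambda>ys. g (y # ys)) powr hyper_exp)"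
    using 3 by (auto intro!: ex2_mono k)
  also have "\<dots> \<le> bad_prob e (P # Ps) (Suc i) f powr hyper_exp * bad_prob e (P # Ps) (Suc i) g powr hyper_exp"
    unfolding bad_prob.simps using 3 by (intro hypercontractive bad_prob_nonneg k) auto
  finally show ?case .
qed auto

lemma bad_variance:
  assumes g: "good P" and e: "0 \<le> e"
  shows "lam * e\<^sup>2 * of_bool (bad e P Ps f) \<le>
    ex1 P (\<lambda>x. (E1 Ps (\<lambda>xs. f (x # xs)))\<^sup>2) - (E1 (P # Ps) f)\<^sup>2"
proof -
  note k = good_kern[OF g]
  define u where "u = (\<lambda>x. E1 Ps (\<lambda>xs. f (x # xs)))"
  have v: "ex1 P (\<lambda>x. (u x)\<^sup>2) - (ex1 P u)\<^sup>2 = ex1 P (\<lambda>x. (u x - ex1 P u)\<^sup>2)"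
    by (simp add: ex1_variance[OF k])
  have "lam * e\<^sup>2 * of_bool (bad e P Ps f) \<le> ex1 P (\<lambda>x. (u x - ex1 P u)\<^sup>2)"
  proof (cases "bad e P Ps f")
    case True
    then obtain x where x: "x \<in> supp P" "e < \<bar>u x - ex1 P u\<bar>" by (auto simp: bad_def u_def)
    have "e\<^sup>2 \<le> (u x - ex1 P u)\<^sup>2" using x e by (simp add: abs_le_square_iff[symmetric])
    then have "lam * e\<^sup>2 \<le> lam * (u x - ex1 P u)\<^sup>2" using lam by (intro mult_left_mono) auto
    also have "\<dots> \<le> ex1 P (\<lambda>x. (u x - ex1 P u)\<^sup>2)" by (intro good_ex1_point g x) auto
    finally show ?thesis using True by simp
  next
    case False
    then show ?thesis by (auto intro!: ex1_nonneg k)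
  qed
  then show ?thesis using v by (simp add: u_def)
qed

text \<open>The variance of \<open>f\<close> is the sum of the expected conditional variances of the
  Doob martingale, and each bad step contributes at least \<open>lam * e\<^sup>2\<close> to
  it.\<close>

lemma sum_bad_prob_le:
  assumes "list_all good Ps" "0 \<le> e"
  shows "lam * e\<^sup>2 * (\<Sum>i<length Ps. bad_prob e Ps i f) \<le> E1 Ps (\<lambda>xs. (f xs)\<^sup>2) - (E1 Ps f)\<^sup>2"
  using assms
proof (induction Ps arbitrary: f)
  case Nil
  then show ?case by simp
next
  case (Cons P Ps)
  have g: "good P" and k: "kern P" using Cons.prems good_kern by auto
  define u where "u = (\<lambda>x. E1 Ps (\<lambda>xs. f (x # xs)))"
  have "lam * e\<^sup>2 * (\<Sum>i<length (P # Ps). bad_prob e (P # Ps) i f)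
      = lam * e\<^sup>2 * of_bool (bad e P Ps f)
        + ex1 P (\<lambda>x. lam * e\<^sup>2 * (\<Sum>i<length Ps. bad_prob e Ps i (\<lambda>xs. f (x # xs))))"
    by (simp add: sum.lessThan_Suc_shift ex1_sum[symmetric] ex1_cmult algebra_simps
        del: sum.lessThan_Suc)
  also have "\<dots> \<le> (ex1 P (\<lambda>x. (u x)\<^sup>2) - (E1 (P # Ps) f)\<^sup>2)
       + ex1 P (\<lambda>x. E1 Ps (\<lambda>xs. (f (x # xs))\<^sup>2) - (u x)\<^sup>2)"
    using bad_variance[OF g Cons.prems(2), of Ps f] Cons
    by (intro add_mono ex1_mono k) (auto simp: u_def)
  also have "\<dots> = E1 (P # Ps) (\<lambda>xs. (f xs)\<^sup>2) - (E1 (P # Ps) f)\<^sup>2" by (simp add: ex1_diff)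
  finally show ?case .
qed

text \<open>A martingale increment averages over the later coordinates, so by
  \<open>E1_square_le\<close> its variance is at most the influence of its coordinate.\<close>

lemma bad_prob_le_infl:
  "list_all good Ps \<Longrightarrow> 0 \<le> e \<Longrightarrow> lam * e\<^sup>2 * bad_prob e Ps i f \<le> infl Ps i f"
proof (induction e Ps i f rule: bad_prob.induct)
  case (2 e P Ps f)
  then have g: "good P" and k: "kern P" "list_all kern Ps" using good_kern list_good_kern by auto
  define u where "u = (\<lambda>x. E1 Ps (\<lambda>xs. f (x # xs)))"
  define h where "h x xs = f (x # xs) - ex1 P (\<lambda>x. f (x # xs))" for x xs
  have u: "u x - ex1 P u = E1 Ps (h x)" for x
    unfolding h_def E1_diff E1_ex1 u_def by simp
  have "lam * e\<^sup>2 * bad_prob e (P # Ps) 0 f \<le> ex1 P (\<lambda>x. (u x - ex1 P u)\<^sup>2)"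
    using bad_variance[OF g, of e Ps f] 2 by (simp add: ex1_variance[OF k(1)] u_def)
  also have "\<dots> \<le> ex1 P (\<lambda>x. E1 Ps (\<lambda>xs. (h x xs)\<^sup>2))"
    unfolding u by (intro ex1_mono k E1_square_le)
  also have "\<dots> = infl (P # Ps) 0 f"
    by (simp add: E1_ex1[symmetric] h_def ex1_variance[OF k(1)])
  finally show ?case .
next
  case (3 e P Ps i f)
  then have k: "kern P" using good_kern by auto
  have "lam * e\<^sup>2 * bad_prob e (P # Ps) (Suc i) f
      = ex1 P (\<lambda>x. lam * e\<^sup>2 * bad_prob e Ps i (\<lambda>xs. f (x # xs)))"
    by (simp add: ex1_cmult)
  also have "\<dots> \<le> infl (P # Ps) (Suc i) f" using 3 by (auto intro!: ex1_mono k)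
  finally show ?case .
qed auto

text \<open>Each conflict has probability at most \<open>p powr (1 + hyper_gain)\<close>, where
  \<open>p\<close> is the probability of a bad step. One factor \<open>p\<close> is summed with the
  variance bound, the remaining power is uniformly small by the influence bound.\<close>

lemma sum_both_bad_prob_le:
  assumes g: "list_all good Ps" and e: "0 < e" and f: "\<And>xs. 0 \<le> f xs" "\<And>xs. f xs \<le> 1"
    and \<tau>: "\<And>i. i < length Ps \<Longrightarrow> infl Ps i f \<le> \<tau>"
  shows "(\<Sum>i<length Ps. both_bad_prob e Ps i f f) \<le> (\<tau> / (lam * e\<^sup>2)) powr hyper_gain / (lam * e\<^sup>2)"
proof -
  note k = list_good_kern[OF g]
  define c where "c = lam * e\<^sup>2"
  have c: "0 < c" using e lam by (simp add: c_def)
  have "E1 Ps (\<lambda>xs. (f xs)\<^sup>2) \<le> 1" using f by (intro E1_le_const k) (simp add: power_le_one)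
  then have "E1 Ps (\<lambda>xs. (f xs)\<^sup>2) - (E1 Ps f)\<^sup>2 \<le> 1"
    using zero_le_power2[of "E1 Ps f"] by linarith
  then have s: "(\<Sum>i<length Ps. bad_prob e Ps i f) \<le> 1 / c"
    using sum_bad_prob_le[OF g, of e f] e c by (simp add: c_def[symmetric] field_simps)
  have "(\<Sum>i<length Ps. both_bad_prob e Ps i f f) \<le> (\<Sum>i<length Ps. (\<tau> / c) powr hyper_gain * bad_prob e Ps i f)"
  proof (intro sum_mono)
    fix i assume "i \<in> {..<length Ps}"
    then have i: "infl Ps i f \<le> \<tau>" using \<tau> by simp
    define p where "p = bad_prob e Ps i f"
    have p0: "0 \<le> p" unfolding p_def by (rule bad_prob_nonneg[OF k])
    have "c * p \<le> \<tau>" using bad_prob_le_infl[OF g, of e i f] e i by (simp add: c_def p_def)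
    then have pt: "p \<le> \<tau> / c" using c by (simp add: field_simps)
    have "both_bad_prob e Ps i f f \<le> p powr hyper_exp * p powr hyper_exp"
      unfolding p_def by (rule both_bad_prob_le[OF g])
    also have "\<dots> = p powr (hyper_gain + 1)"
    proof -
      have "hyper_exp + hyper_exp = hyper_gain + 1" by (simp add: hyper_exp_def field_simps)
      then show ?thesis by (simp only: powr_add[symmetric])
    qed
    also have "\<dots> = p powr hyper_gain * p" using p0 by (simp add: powr_add)
    also have "\<dots> \<le> (\<tau> / c) powr hyper_gain * p"
      using p0 pt hyper_gain by (intro mult_right_mono powr_mono2) auto
    finally show "both_bad_prob e Ps i f f \<le> (\<tau> / c) powr hyper_gain * bad_prob e Ps i f" by (simp add: p_def)
  qed
  also have "\<dots> = (\<tau> / c) powr hyper_gain * (\<Sum>i<length Ps. bad_prob e Ps i f)" by (simp add: sum_distrib_left)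
  also have "\<dots> \<le> (\<tau> / c) powr hyper_gain * (1 / c)" using s by (intro mult_left_mono) auto
  finally show ?thesis by (simp add: c_def)
qed

end

section \<open>Smoothing\<close>

context alphabet
begin

text \<open>Each coordinate is resampled independently with probability \<open>1 - r\<close>.\<close>

primrec smooth :: "real \<Rightarrow> ('a \<Rightarrow> 'a \<Rightarrow> real) list \<Rightarrow> ('a list \<Rightarrow> real) \<Rightarrow> 'a list \<Rightarrow> real" where
  "smooth r [] f xs = f []"
| "smooth r (P # Ps) f xs =
     smooth r Ps (\<lambda>ys. r * f (hd xs # ys) + (1 - r) * ex1 P (\<lambda>z. f (z # ys))) (tl xs)"

lemma smooth_add: "smooth r Ps (\<lambda>xs. f xs + g xs) xs = smooth r Ps f xs + smooth r Ps g xs"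
proof (induction Ps arbitrary: f g xs)
  case (Cons P Ps)
  show ?case by (simp add: Cons.IH[symmetric] ex1_add algebra_simps)
qed simp

lemma smooth_cmult: "smooth r Ps (\<lambda>xs. c * f xs) xs = c * smooth r Ps f xs"
proof (induction Ps arbitrary: f xs)
  case (Cons P Ps)
  show ?case by (simp add: Cons.IH[symmetric] ex1_cmult algebra_simps)
qed simp

lemma smooth_sum: "finite I \<Longrightarrow> smooth r Ps (\<lambda>xs. \<Sum>i\<in>I. f i xs) xs = (\<Sum>i\<in>I. smooth r Ps (f i) xs)"
proof (induction I rule: finite_induct)
  case empty
  show ?case using smooth_cmult[of r Ps 0 "\<lambda>_. 0" xs] by simp
next
  case (insert i I)
  then show ?case by (simp add: smooth_add)
qed

lemma smooth_ex1: "smooth r Ps (\<lambda>xs. ex1 P (\<lambda>x. f x xs)) xs = ex1 P (\<lambda>x. smooth r Ps (f x) xs)"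
  by (simp add: ex1_def smooth_sum finite_A smooth_cmult)

lemma smooth_range:
  assumes "list_all kern Ps" "0 \<le> r" "r \<le> 1" "\<And>xs. 0 \<le> f xs \<and> f xs \<le> 1"
  shows "0 \<le> smooth r Ps f xs \<and> smooth r Ps f xs \<le> 1"
  using assms
proof (induction Ps arbitrary: f xs)
  case (Cons P Ps)
  have k: "kern P" using Cons.prems by simp
  have "0 \<le> r * f (hd xs # ys) + (1 - r) * ex1 P (\<lambda>z. f (z # ys)) \<and>
      r * f (hd xs # ys) + (1 - r) * ex1 P (\<lambda>z. f (z # ys)) \<le> 1" for ys
  proof -
    have "0 \<le> ex1 P (\<lambda>z. f (z # ys))" "ex1 P (\<lambda>z. f (z # ys)) \<le> ex1 P (\<lambda>z. 1)"
      using Cons.prems by (auto intro!: ex1_nonneg ex1_mono k)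
    then have m: "0 \<le> ex1 P (\<lambda>z. f (z # ys))" "ex1 P (\<lambda>z. f (z # ys)) \<le> 1"
      by (simp_all add: ex1_const[OF k])
    have "r * f (hd xs # ys) + (1 - r) * ex1 P (\<lambda>z. f (z # ys)) \<le> 1"
      using m Cons.prems by (intro convex_bound_le) auto
    then show ?thesis using m Cons.prems by simp
  qed
  then show ?case using Cons.prems unfolding smooth.simps by (intro Cons.IH) auto
qed simp

lemma E1_smooth: "list_all kern Ps \<Longrightarrow> E1 Ps (smooth r Ps f) = E1 Ps f"
proof (induction Ps arbitrary: f)
  case (Cons P Ps)
  then have k: "kern P" by simp
  have "E1 (P # Ps) (smooth r (P # Ps) f) =
      ex1 P (\<lambda>x. r * E1 Ps (\<lambda>xs. f (x # xs)) + (1 - r) * ex1 P (\<lambda>z. E1 Ps (\<lambda>xs. f (z # xs))))"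
    using Cons by (simp add: E1_add E1_cmult E1_ex1)
  also have "\<dots> = E1 (P # Ps) f"
    by (simp only: ex1_add ex1_cmult ex1_const[OF k] E1.simps) (simp add: algebra_simps)
  finally show ?case .
qed simp

text \<open>
  Only \<open>c = 1\<close> is of interest, but splitting off the mean in one coordinate turns \<open>c\<close> into
  \<open>c * r\<^sup>2\<close> on the remaining part, which at the same time gains a factor \<open>rho\<close>.
\<close>

definition smoothing_defect :: "real \<Rightarrow> ('a \<Rightarrow> 'a \<Rightarrow> real) list \<Rightarrow> real \<Rightarrow> ('a list \<Rightarrow> real) \<Rightarrow> ('a list \<Rightarrow> real) \<Rightarrow> real" where
  "smoothing_defect r Ps c f h = E2 Ps (\<lambda>xs ys. f xs * h ys) - c * E2 Ps (\<lambda>xs ys. smooth r Ps f xs * smooth r Ps h ys)"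

lemma smoothing_defect_add_left: "smoothing_defect r Ps c (\<lambda>xs. f xs + g xs) h = smoothing_defect r Ps c f h + smoothing_defect r Ps c g h"
  by (simp add: smoothing_defect_def smooth_add E2_add algebra_simps)

lemma smoothing_defect_add_right: "smoothing_defect r Ps c f (\<lambda>xs. g xs + h xs) = smoothing_defect r Ps c f g + smoothing_defect r Ps c f h"
  by (simp add: smoothing_defect_def smooth_add E2_add algebra_simps)

lemma smoothing_defect_cmult_left: "smoothing_defect r Ps c (\<lambda>xs. a * f xs) h = a * smoothing_defect r Ps c f h"
  by (simp add: smoothing_defect_def smooth_cmult E2_cmult mult.assoc algebra_simps)

lemma smoothing_defect_cmult_right: "smoothing_defect r Ps c f (\<lambda>xs. a * h xs) = a * smoothing_defect r Ps c f h"
  by (simp add: smoothing_defect_def smooth_cmult E2_cmult mult.left_commute[of _ a] algebra_simps)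

lemma smoothing_defect_sum_right:
  "finite I \<Longrightarrow> smoothing_defect r Ps c f (\<lambda>xs. \<Sum>i\<in>I. h i xs) = (\<Sum>i\<in>I. smoothing_defect r Ps c f (h i))"
  by (simp add: smoothing_defect_def smooth_sum sum_distrib_left E2_sum sum_subtractf)

lemma smoothing_defect_ex1_right: "smoothing_defect r Ps c f (\<lambda>xs. ex1 P (\<lambda>x. h x xs)) = ex1 P (\<lambda>x. smoothing_defect r Ps c f (h x))"
  by (simp add: ex1_def smoothing_defect_sum_right finite_A smoothing_defect_cmult_right)

lemma smoothing_defect_sum_left:
  "finite I \<Longrightarrow> smoothing_defect r Ps c (\<lambda>xs. \<Sum>i\<in>I. f i xs) h = (\<Sum>i\<in>I. smoothing_defect r Ps c (f i) h)"
  by (simp add: smoothing_defect_def smooth_sum sum_distrib_right sum_distrib_left E2_sum sum_subtractf)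

lemma smoothing_defect_ex1_left: "smoothing_defect r Ps c (\<lambda>xs. ex1 P (\<lambda>x. f x xs)) h = ex1 P (\<lambda>x. smoothing_defect r Ps c (f x) h)"
  by (simp add: ex1_def smoothing_defect_sum_left finite_A smoothing_defect_cmult_left)

text \<open>By linearity in \<open>h\<close> the average over \<open>y\<close> given
  \<open>x\<close> moves inside, which makes the contraction of conditional means
  applicable.\<close>

lemma ex2_smoothing_defect:
  assumes "kern P"
  shows "ex2 P (\<lambda>x y. smoothing_defect r Ps c (f x) (h y)) = ex1 P (\<lambda>x. smoothing_defect r Ps c (f x) (\<lambda>ys. cond_mean P (\<lambda>y. h y ys) x))"
proof -
  have "(\<Sum>y\<in>A. P x y * smoothing_defect r Ps c (f x) (h y)) = mg P x * smoothing_defect r Ps c (f x) (\<lambda>ys. cond_mean P (\<lambda>y. h y ys) x)"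
    if "x \<in> A" for x
    unfolding smoothing_defect_cmult_right[symmetric] mg_cond_mean[OF assms that] by (simp add: smoothing_defect_sum_right finite_A)
  then show ?thesis by (simp add: ex2_def ex1_def)
qed

text \<open>Split off the mean \<open>fb\<close> over the first coordinate from the centred part
  \<open>ft\<close>. Smoothing there fixes \<open>fb\<close> and multiplies \<open>ft\<close> by
  \<open>r\<close>, and mixed terms average to zero.\<close>

lemma smoothing_defect_Cons:
  assumes k: "kern P"
  defines "fb \<equiv> \<lambda>f ys. ex1 P (\<lambda>z. f (z # ys))"
  defines "ft \<equiv> \<lambda>f x ys. f (x # ys) - ex1 P (\<lambda>z. f (z # ys))"
  shows "smoothing_defect r (P # Ps) c f h = smoothing_defect r Ps c (fb f) (fb h)
    + ex2 P (\<lambda>x y. smoothing_defect r Ps (c * r\<^sup>2) (ft f x) (ft h y))"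
proof -
  have z: "ex1 P (\<lambda>x. ft g x ys) = 0" for g ys
    by (simp add: ft_def ex1_diff ex1_const[OF k])
  have s: "smooth r (P # Ps) g (x # xs) = smooth r Ps (fb g) xs + r * smooth r Ps (ft g x) xs" for g x xs
    unfolding smooth_cmult[symmetric] smooth_add[symmetric]
    by (simp add: fb_def ft_def algebra_simps)
  have cross: "ex2 P (\<lambda>x y. smoothing_defect r Ps d (ft f x) (fb h)) = 0" "ex2 P (\<lambda>x y. smoothing_defect r Ps d (fb f) (ft h y)) = 0" for d
  proof -
    have 0: "smoothing_defect r Ps d (\<lambda>xs. 0) g = 0" "smoothing_defect r Ps d g (\<lambda>xs. 0) = 0" for g
      using smoothing_defect_cmult_left[of r Ps d 0 "\<lambda>_. 0" g] smoothing_defect_cmult_right[of r Ps d g 0 "\<lambda>_. 0"] by simp_all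
    show "ex2 P (\<lambda>x y. smoothing_defect r Ps d (ft f x) (fb h)) = 0"
      unfolding ex2_fst smoothing_defect_ex1_left[symmetric] z by (rule 0)
    show "ex2 P (\<lambda>x y. smoothing_defect r Ps d (fb f) (ft h y)) = 0"
      unfolding ex2_snd[OF k] smoothing_defect_ex1_right[symmetric] z by (rule 0)
  qed
  \<comment> \<open>The value 0 of the parameter is the plain pairing and the difference to the
    value 1 is the smoothed one, so \<open>cross\<close> for all \<open>d\<close> removes the mixed
    terms of both.\<close>
  have E2z: "E2 Ps (\<lambda>xs ys. u xs * v ys) = smoothing_defect r Ps 0 u v" for u v by (simp add: smoothing_defect_def)
  have sq: "smoothing_defect r Ps c u v + (c - c * r\<^sup>2) * E2 Ps (\<lambda>xs ys. smooth r Ps u xs * smooth r Ps v ys)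
      = smoothing_defect r Ps (c * r\<^sup>2) u v" for u v
    by (simp add: smoothing_defect_def algebra_simps)
  have m: "smoothing_defect r Ps d (ft f x) (ft h y) + smoothing_defect r Ps d (ft f x) (fb h) + smoothing_defect r Ps d (fb f) (ft h y) + smoothing_defect r Ps d (fb f) (fb h)
     = smoothing_defect r Ps d (\<lambda>xs. f (x # xs)) (\<lambda>ys. h (y # ys))" for d x y
  proof -
    have "smoothing_defect r Ps d (\<lambda>xs. f (x # xs)) (\<lambda>ys. h (y # ys))
      = smoothing_defect r Ps d (\<lambda>xs. ft f x xs + fb f xs) (\<lambda>ys. ft h y ys + fb h ys)"
      by (simp add: ft_def fb_def)
    then show ?thesis unfolding smoothing_defect_add_left smoothing_defect_add_right by simp
  qed
  have "E2 (P # Ps) (\<lambda>xs ys. f xs * h ys) = ex2 P (\<lambda>x y. smoothing_defect r Ps 0 (ft f x) (ft h y)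
      + smoothing_defect r Ps 0 (ft f x) (fb h) + smoothing_defect r Ps 0 (fb f) (ft h y) + smoothing_defect r Ps 0 (fb f) (fb h))"
    unfolding m by (simp add: E2z)
  also have "\<dots> = ex2 P (\<lambda>x y. smoothing_defect r Ps 0 (ft f x) (ft h y)) + smoothing_defect r Ps 0 (fb f) (fb h)"
    by (simp only: ex2_add cross ex2_const[OF k])
  finally have 1: "E2 (P # Ps) (\<lambda>xs ys. f xs * h ys)
      = ex2 P (\<lambda>x y. E2 Ps (\<lambda>xs ys. ft f x xs * ft h y ys)) + E2 Ps (\<lambda>xs ys. fb f xs * fb h ys)"
    by (simp add: E2z)
  define B where "B u v = E2 Ps (\<lambda>xs ys. smooth r Ps u xs * smooth r Ps v ys)" for u v
  have B: "B u v = smoothing_defect r Ps 0 u v - smoothing_defect r Ps 1 u v" for u v by (simp add: B_def smoothing_defect_def)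
  have "E2 (P # Ps) (\<lambda>xs ys. smooth r (P # Ps) f xs * smooth r (P # Ps) h ys)
     = ex2 P (\<lambda>x y. r\<^sup>2 * B (ft f x) (ft h y) + r * B (ft f x) (fb h) + r * B (fb f) (ft h y) + B (fb f) (fb h))"
    unfolding E2.simps s B_def E2_cmult[symmetric] E2_add[symmetric]
    by (simp add: power2_eq_square algebra_simps)
  also have "\<dots> = r\<^sup>2 * ex2 P (\<lambda>x y. B (ft f x) (ft h y)) + B (fb f) (fb h)"
    by (simp only: B ex2_add ex2_cmult ex2_diff cross ex2_const[OF k]) simp
  finally have 2: "E2 (P # Ps) (\<lambda>xs ys. smooth r (P # Ps) f xs * smooth r (P # Ps) h ys)
     = r\<^sup>2 * ex2 P (\<lambda>x y. B (ft f x) (ft h y)) + B (fb f) (fb h)" .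
  show ?thesis
    unfolding smoothing_defect_def[of r "P # Ps"] 1 2
    unfolding smoothing_defect_def B_def[symmetric] ex2_diff ex2_cmult by (simp add: algebra_simps)
qed

end

context connected_alphabet
begin

text \<open>Induction with \<open>c\<close> arbitrary: the mean part keeps \<open>c\<close>, the
  centred part continues with \<open>c * r\<^sup>2\<close>. At \<open>c = 1\<close> the bound is of
  order \<open>1 - r\<^sup>2\<close>, uniformly in the number of coordinates.\<close>

lemma smoothing_defect_le:
  assumes "list_all good Ps" "0 \<le> c" "c \<le> 1" "0 \<le> r" "r \<le> 1"
  shows "smoothing_defect r Ps c f h \<le> (1 - c + rho / (1 - rho) * (1 - r\<^sup>2)) / 2 *
     (E1 Ps (\<lambda>xs. (f xs)\<^sup>2) + E1 Ps (\<lambda>xs. (h xs)\<^sup>2))"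
  using assms
proof (induction Ps arbitrary: c f h)
  case Nil
  define K where "K = rho / (1 - rho) * (1 - r\<^sup>2)"
  have K: "0 \<le> K" using rho Nil by (auto simp: K_def power_le_one intro!: mult_nonneg_nonneg)
  have "(1 - c) * (f [] * h []) \<le> (1 - c) * (((f [])\<^sup>2 + (h [])\<^sup>2) / 2)"
    using sum_squares_bound[of "f []" "h []"] Nil by (intro mult_left_mono) auto
  also have "\<dots> \<le> (1 - c + K) * (((f [])\<^sup>2 + (h [])\<^sup>2) / 2)"
    using K by (intro mult_right_mono) auto
  finally have "(1 - c) * (f [] * h []) \<le> (1 - c + K) / 2 * ((f [])\<^sup>2 + (h [])\<^sup>2)" by simp
  moreover have "smoothing_defect r [] c f h = (1 - c) * (f [] * h [])" by (simp add: smoothing_defect_def algebra_simps)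
  ultimately show ?case by (simp add: K_def)
next
  case (Cons P Ps)
  define K where "K = rho / (1 - rho) * (1 - r\<^sup>2)"
  have r2: "0 \<le> r\<^sup>2" "r\<^sup>2 \<le> 1" using Cons.prems by (auto simp: power_le_one)
  have K: "0 \<le> K" using rho r2 by (simp add: K_def)
  have g: "good P" and k: "kern P" "list_all kern Ps" and gs: "list_all good Ps"
    using Cons.prems good_kern list_good_kern by auto
  define fb where "fb = (\<lambda>f ys. ex1 P (\<lambda>z. f (z # ys)))"
  define ft where "ft = (\<lambda>f x ys. f (x # ys) - ex1 P (\<lambda>z. f (z # ys)))"
  define N where "N f = E1 Ps (\<lambda>ys. (fb f ys)\<^sup>2)" for f
  define M where "M f = ex1 P (\<lambda>x. E1 Ps (\<lambda>ys. (ft f x ys)\<^sup>2))" for f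
  have NM: "0 \<le> N f" "0 \<le> M f" for f
    unfolding N_def M_def using k by (auto intro!: E1_nonneg ex1_nonneg)
  have norm: "E1 (P # Ps) (\<lambda>xs. (f xs)\<^sup>2) = N f + M f" for f
  proof -
    have "M f = E1 Ps (\<lambda>ys. ex1 P (\<lambda>x. (f (x # ys))\<^sup>2) - (fb f ys)\<^sup>2)"
      by (simp add: M_def E1_ex1[symmetric] ft_def fb_def ex1_variance[OF k(1)])
    then show ?thesis by (simp add: E1_diff E1_ex1 N_def)
  qed
  have 1: "smoothing_defect r Ps c (fb f) (fb h) \<le> (1 - c + K) / 2 * (N f + N h)"
    unfolding N_def K_def using Cons.prems by (intro Cons.IH) auto
  define d where "d = c * r\<^sup>2"
  have d: "0 \<le> d" "d \<le> 1" using Cons.prems r2 by (auto simp: d_def mult_le_one)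
  define T where "T = (\<lambda>x ys. cond_mean P (\<lambda>y. ft h y ys) x)"
  have "ex1 P (\<lambda>x. E1 Ps (\<lambda>ys. (T x ys)\<^sup>2)) \<le> rho\<^sup>2 * M h"
  proof -
    have "ex1 P (\<lambda>x. E1 Ps (\<lambda>ys. (T x ys)\<^sup>2)) = E1 Ps (\<lambda>ys. ex1 P (\<lambda>x. (T x ys)\<^sup>2))"
      by (simp add: E1_ex1)
    also have "\<dots> \<le> E1 Ps (\<lambda>ys. rho\<^sup>2 * ex1 P (\<lambda>x. (ft h x ys)\<^sup>2))"
      unfolding T_def by (intro E1_mono k cond_mean_contraction g) (simp add: ft_def ex1_diff ex1_const[OF k(1)])
    also have "\<dots> = rho\<^sup>2 * M h" by (simp add: E1_cmult E1_ex1 M_def)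
    finally show ?thesis .
  qed
  then have T: "1 / rho * ex1 P (\<lambda>x. E1 Ps (\<lambda>ys. (T x ys)\<^sup>2)) \<le> rho * M h"
    using rho(1) by (simp add: field_simps power2_eq_square)
  \<comment> \<open>Scaling by \<open>q\<close> and \<open>1 / q\<close> balances the norms:
    \<open>T\<close> has gained \<open>rho\<^sup>2\<close> by contraction and loses one
    \<open>rho\<close> again, so both centred parts end with the factor \<open>rho\<close>.\<close>
  define q where "q = sqrt rho"
  have q: "0 < q" "q\<^sup>2 = rho" using rho by (simp_all add: q_def)
  have "ex2 P (\<lambda>x y. smoothing_defect r Ps d (ft f x) (ft h y)) = ex1 P (\<lambda>x. smoothing_defect r Ps d (ft f x) (T x))"
    unfolding T_def by (rule ex2_smoothing_defect[OF k(1)])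
  also have "\<dots> \<le> ex1 P (\<lambda>x. (1 - d + K) / 2 *
      (rho * E1 Ps (\<lambda>ys. (ft f x ys)\<^sup>2) + 1 / rho * E1 Ps (\<lambda>ys. (T x ys)\<^sup>2)))"
  proof (intro ex1_mono k)
    fix x
    have "smoothing_defect r Ps d (ft f x) (T x) = smoothing_defect r Ps d (\<lambda>ys. q * ft f x ys) (\<lambda>ys. 1 / q * T x ys)"
      using q by (simp only: smoothing_defect_cmult_left smoothing_defect_cmult_right) simp
    also have "\<dots> \<le> (1 - d + K) / 2 * (E1 Ps (\<lambda>ys. (q * ft f x ys)\<^sup>2) + E1 Ps (\<lambda>ys. (1 / q * T x ys)\<^sup>2))"
      unfolding K_def using gs d Cons.prems by (intro Cons.IH)
    finally show "smoothing_defect r Ps d (ft f x) (T x) \<le> (1 - d + K) / 2 *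
      (rho * E1 Ps (\<lambda>ys. (ft f x ys)\<^sup>2) + 1 / rho * E1 Ps (\<lambda>ys. (T x ys)\<^sup>2))"
      by (simp only: power_mult_distrib E1_cmult power_divide q) simp
  qed
  also have "\<dots> = (1 - d + K) / 2 * (rho * M f + 1 / rho * ex1 P (\<lambda>x. E1 Ps (\<lambda>ys. (T x ys)\<^sup>2)))"
    by (simp only: ex1_cmult ex1_add M_def)
  also have "\<dots> \<le> (1 - d + K) / 2 * (rho * M f + rho * M h)"
    using T d K by (intro mult_left_mono add_left_mono) auto
  also have "\<dots> = rho * (1 - d + K) / 2 * (M f + M h)"
    unfolding distrib_left[symmetric] by simp
  also have "\<dots> \<le> (1 - c + K) / 2 * (M f + M h)"
  proof -
    \<comment> \<open>This fixed point equation is the reason for the form of \<open>K\<close>: the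
      factor \<open>rho\<close> pays for the decrease of \<open>c\<close> to
      \<open>c * r\<^sup>2\<close>.\<close>
    have "K = rho * (1 - r\<^sup>2) + rho * K" using rho by (simp add: K_def field_simps)
    moreover have "rho * (c * (1 - r\<^sup>2)) \<le> rho * (1 - r\<^sup>2)"
      using Cons.prems r2 rho by (intro mult_left_mono) (auto simp: mult_left_le_one_le)
    moreover have "rho * (1 - c) \<le> 1 - c" using rho Cons.prems by (simp add: mult_left_le_one_le)
    moreover have "rho * (1 - d + K) = rho * (1 - c) + rho * (c * (1 - r\<^sup>2)) + rho * K"
      by (simp add: d_def algebra_simps)
    ultimately have "rho * (1 - d + K) \<le> 1 - c + K" by linarith
    then show ?thesis using NM by (intro mult_right_mono) (auto simp: add_nonneg_nonneg)
  qed
  finally have 2: "ex2 P (\<lambda>x y. smoothing_defect r Ps (c * r\<^sup>2) (ft f x) (ft h y)) \<le> (1 - c + K) / 2 * (M f + M h)"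
    by (simp add: d_def)
  have "smoothing_defect r (P # Ps) c f h \<le> (1 - c + K) / 2 * (N f + N h) + (1 - c + K) / 2 * (M f + M h)"
    using 1 2 smoothing_defect_Cons[OF k(1), of r Ps c f h] by (simp add: fb_def ft_def)
  then show ?case unfolding norm K_def[symmetric] by (simp only: distrib_left add_ac)
qed

end

section \<open>Energy increment\<close>

context alphabet
begin

lemma ex1_swap: "ex1 P (\<lambda>x. ex1 Q (\<lambda>y. f x y)) = ex1 Q (\<lambda>y. ex1 P (\<lambda>x. f x y))"
  unfolding ex1_def sum_distrib_left by (subst sum.swap) (simp only: mult.left_commute)

lemma infl_affine: "list_all kern Ps \<Longrightarrow> infl Ps i (\<lambda>xs. a + b * f xs) = b\<^sup>2 * infl Ps i f"
proof (induction Ps i f rule: infl.induct)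
  case (2 P Ps f)
  then have k: "kern P" by simp
  have "ex1 P (\<lambda>x. (a + b * u x)\<^sup>2) - (ex1 P (\<lambda>x. a + b * u x))\<^sup>2
      = b\<^sup>2 * (ex1 P (\<lambda>x. (u x)\<^sup>2) - (ex1 P u)\<^sup>2)" for u
  proof -
    have "(a + b * u x) - ex1 P (\<lambda>x. a + b * u x) = b * (u x - ex1 P u)" for x
      by (simp add: ex1_add ex1_cmult ex1_const[OF k] algebra_simps)
    then show ?thesis
      by (simp add: ex1_variance[OF k, symmetric] power_mult_distrib ex1_cmult)
  qed
  then show ?case by (simp add: E1_cmult)
qed (auto simp: ex1_cmult)

text \<open>The fixed coordinate remains as a dummy argument, so that the list of laws does not
  change during the iteration.\<close>

definition restr :: "nat \<Rightarrow> 'a \<Rightarrow> ('a list \<Rightarrow> real) \<Rightarrow> 'a list \<Rightarrow> real" where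
  "restr i a f xs = f (xs[i := a])"

lemma restr_Cons: "restr 0 a f (x # xs) = f (a # xs)"
  "restr (Suc i) a f (x # xs) = restr i a (\<lambda>xs. f (x # xs)) xs"
  by (simp_all add: restr_def)

lemma E1_restr:
  "list_all kern Ps \<Longrightarrow> i < length Ps \<Longrightarrow> ex1 (Ps ! i) (\<lambda>a. E1 Ps (restr i a f)) = E1 Ps f"
proof (induction Ps arbitrary: i f)
  case (Cons P Ps)
  show ?case
  proof (cases i)
    case 0
    then show ?thesis using Cons.prems by (simp add: restr_Cons ex1_const)
  next
    case (Suc j)
    then show ?thesis using Cons by (simp add: restr_Cons ex1_swap[of "Ps ! j"])
  qed
qed simp

definition energy :: "real \<Rightarrow> ('a \<Rightarrow> 'a \<Rightarrow> real) list \<Rightarrow> ('a list \<Rightarrow> real) \<Rightarrow> real" where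
  "energy r Ps f = E1 Ps (\<lambda>xs. (smooth r Ps f xs)\<^sup>2)"

lemma energy_Cons:
  "energy r (P # Ps) f = ex1 P (\<lambda>x. energy r Ps (\<lambda>ys. r * f (x # ys) + (1 - r) * ex1 P (\<lambda>z. f (z # ys))))"
  by (simp add: energy_def)

text \<open>Fixing coordinate \<open>i\<close> to a random value undoes the smoothing in it: its
  expected variance rises from \<open>r\<^sup>2 * V\<close> to \<open>V\<close>, and the influence
  on the smoothed function is \<open>r\<^sup>2 * V\<close>.\<close>

lemma energy_restr:
  "list_all kern Ps \<Longrightarrow> i < length Ps \<Longrightarrow> r \<noteq> 0 \<Longrightarrow>
    ex1 (Ps ! i) (\<lambda>a. energy r Ps (restr i a f)) =
    energy r Ps f + (1 - r\<^sup>2) / r\<^sup>2 * infl Ps i (smooth r Ps f)"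
proof (induction Ps arbitrary: i f)
  case (Cons P Ps)
  have k: "kern P" using Cons.prems by simp
  define g where "g = (\<lambda>x ys. r * f (x # ys) + (1 - r) * ex1 P (\<lambda>z. f (z # ys)))"
  show ?case
  proof (cases i)
    case 0
    define h where "h x = smooth r Ps (\<lambda>xs. f (x # xs))" for x
    define m where "m xs = ex1 P (\<lambda>x. h x xs)" for xs
    define S where "S = (\<lambda>xs. ex1 P (\<lambda>x. (h x xs)\<^sup>2))"
    have sm: "smooth r (P # Ps) f (x # xs) = r * h x xs + (1 - r) * m xs" for x xs
      by (simp add: h_def m_def smooth_add smooth_cmult smooth_ex1)
    have 1: "ex1 P (\<lambda>x. r * h x xs + (1 - r) * m xs) = m xs" for xs
      by (simp only: ex1_add ex1_cmult ex1_const[OF k] m_def) (simp add: algebra_simps)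
    have 2: "ex1 P (\<lambda>x. (r * h x xs + (1 - r) * m xs)\<^sup>2) = r\<^sup>2 * S xs + (1 - r\<^sup>2) * (m xs)\<^sup>2" for xs
    proof -
      have "ex1 P (\<lambda>x. (r * h x xs + (1 - r) * m xs)\<^sup>2) =
         ex1 P (\<lambda>x. r\<^sup>2 * (h x xs)\<^sup>2 + (2 * r * (1 - r) * m xs) * h x xs + (1 - r)\<^sup>2 * (m xs)\<^sup>2)"
        by (intro arg_cong[of _ _ "ex1 P"] ext) (simp add: power2_eq_square algebra_simps)
      also have "\<dots> = r\<^sup>2 * S xs + (2 * r * (1 - r) * m xs) * m xs + (1 - r)\<^sup>2 * (m xs)\<^sup>2"
        by (simp only: ex1_add ex1_cmult ex1_const[OF k] S_def m_def)
      finally show ?thesis by (simp add: power2_eq_square algebra_simps)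
    qed
    have "ex1 P (\<lambda>a. energy r (P # Ps) (restr 0 a f)) = ex1 P (\<lambda>a. E1 Ps (\<lambda>xs. (h a xs)\<^sup>2))"
      by (simp add: energy_def restr_Cons ex1_const[OF k] h_def algebra_simps)
    also have "\<dots> = E1 Ps S" by (simp add: E1_ex1[symmetric] S_def)
    finally have L: "ex1 P (\<lambda>a. energy r (P # Ps) (restr 0 a f)) = E1 Ps S" .
    have e: "energy r (P # Ps) f = E1 Ps (\<lambda>xs. r\<^sup>2 * S xs + (1 - r\<^sup>2) * (m xs)\<^sup>2)"
      unfolding energy_def E1.simps sm by (simp only: E1_ex1[symmetric] 2)
    have i: "infl (P # Ps) 0 (smooth r (P # Ps) f) = E1 Ps (\<lambda>xs. r\<^sup>2 * S xs + (1 - r\<^sup>2) * (m xs)\<^sup>2 - (m xs)\<^sup>2)"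
      unfolding infl.simps sm by (simp only: 1 2)
    have "energy r (P # Ps) f + (1 - r\<^sup>2) / r\<^sup>2 * infl (P # Ps) 0 (smooth r (P # Ps) f) =
      E1 Ps (\<lambda>xs. r\<^sup>2 * S xs + (1 - r\<^sup>2) * (m xs)\<^sup>2
        + (1 - r\<^sup>2) / r\<^sup>2 * (r\<^sup>2 * S xs + (1 - r\<^sup>2) * (m xs)\<^sup>2 - (m xs)\<^sup>2))"
      unfolding e i by (simp only: E1_cmult E1_add)
    also have "\<dots> = E1 Ps S"
      using Cons.prems(3) by (intro arg_cong[of _ _ "E1 Ps"] ext) (simp add: field_simps)
    finally show ?thesis using 0 L by simp
  next
    case (Suc j)
    have "ex1 (Ps ! j) (\<lambda>a. energy r (P # Ps) (restr (Suc j) a f))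
        = ex1 P (\<lambda>x. ex1 (Ps ! j) (\<lambda>a. energy r Ps (restr j a (g x))))"
      unfolding ex1_swap[of P] energy_Cons by (simp add: restr_def[abs_def] g_def)
    also have "\<dots> = ex1 P (\<lambda>x. energy r Ps (g x) + (1 - r\<^sup>2) / r\<^sup>2 * infl Ps j (smooth r Ps (g x)))"
      using Cons Suc by simp
    also have "\<dots> = energy r (P # Ps) f + (1 - r\<^sup>2) / r\<^sup>2 * infl (P # Ps) (Suc j) (smooth r (P # Ps) f)"
      by (simp only: ex1_add ex1_cmult energy_Cons g_def infl.simps smooth.simps list.sel)
    finally show ?thesis using Suc by simp
  qed
qed simp

end

section \<open>Hitting for products of connected laws\<close>

context connected_alphabet
begin

text \<open>Both sides equal \<open>a\<close> in coordinate \<open>i\<close> with probability at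
  least \<open>lam\<close>, and the other pairs of values contribute nonnegatively.\<close>

lemma E2_restr:
  "list_all good Ps \<Longrightarrow> i < length Ps \<Longrightarrow> a \<in> supp (Ps ! i) \<Longrightarrow> (\<And>xs. 0 \<le> f xs) \<Longrightarrow> (\<And>xs. 0 \<le> g xs) \<Longrightarrow>
   lam * E2 Ps (\<lambda>xs ys. restr i a f xs * restr i a g ys) \<le> E2 Ps (\<lambda>xs ys. f xs * g ys)"
proof (induction Ps arbitrary: i f g)
  case (Cons P Ps)
  have gd: "good P" and k: "kern P" "list_all kern Ps" using Cons.prems good_kern list_good_kern by auto
  show ?case
  proof (cases i)
    case 0
    define h where "h = (\<lambda>x y. E2 Ps (\<lambda>xs ys. f (x # xs) * g (y # ys)))"
    have h0: "0 \<le> h x y" for x y unfolding h_def using Cons.prems by (intro E2_nonneg k) auto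
    have a: "a \<in> supp P" using Cons.prems 0 by simp
    have "lam * h a a \<le> P a a * h a a"
      using gd a h0 by (intro mult_right_mono) (auto simp: good_def)
    also have "\<dots> \<le> ex2 P h" using a h0 by (intro ex2_ge_point k) (auto simp: supp_def)
    finally show ?thesis using 0 by (simp add: restr_Cons ex2_const[OF k(1)] h_def)
  next
    case (Suc j)
    have "lam * E2 (P # Ps) (\<lambda>xs ys. restr i a f xs * restr i a g ys)
      = ex2 P (\<lambda>x y. lam * E2 Ps (\<lambda>xs ys. restr j a (\<lambda>xs. f (x # xs)) xs * restr j a (\<lambda>ys. g (y # ys)) ys))"
      by (simp add: Suc restr_Cons ex2_cmult)
    also have "\<dots> \<le> ex2 P (\<lambda>x y. E2 Ps (\<lambda>xs ys. f (x # xs) * g (y # ys)))"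
      using Cons.prems Suc by (intro ex2_mono k Cons.IH) auto
    finally show ?thesis by simp
  qed
qed simp

lemma low_influence_hitting:
  assumes \<nu>: "0 < \<nu>" "\<nu> \<le> 1"
  shows "\<exists>r \<tau> \<delta>. 0 < r \<and> r < 1 \<and> 0 < \<tau> \<and> 0 < \<delta> \<and>
    (\<forall>Ps f. list_all good Ps \<longrightarrow> (\<forall>xs. 0 \<le> f xs \<and> f xs \<le> 1) \<longrightarrow> \<nu> \<le> E1 Ps f \<longrightarrow>
      (\<forall>i<length Ps. infl Ps i (smooth r Ps f) \<le> \<tau>) \<longrightarrow> \<delta> \<le> E2 Ps (\<lambda>xs ys. f xs * f ys))"
proof -
  \<comment> \<open>Chosen so that \<open>6 * \<theta> = \<nu>\<^sup>2 / 2\<close>: where the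
    smoothed product is below \<open>3 * \<theta>\<close>, the shifted one is below
    \<open>\<nu>\<^sup>2 / 2\<close>, and its power is at most \<open>w / 4\<close>.\<close>
  define \<theta> where "\<theta> = \<nu>\<^sup>2 / 12"
  define w where "w = \<nu> ^ sub_exp * \<nu> ^ sub_exp"
  define e where "e = tiny_dev * \<theta>"
  define c where "c = lam * e\<^sup>2"
  \<comment> \<open>Solves \<open>(\<tau> / c) powr hyper_gain / c = w / 4\<close>, so that
    conflicts cost at most a quarter of \<open>w\<close>.\<close>
  define \<tau> where "\<tau> = c * (w * c / 4) powr (1 / hyper_gain)"
  define K where "K = rho / (1 - rho)"
  \<comment> \<open>The smoothing error is at most \<open>K * (1 - r\<^sup>2) \<le> w / 16\<close>;
    the cap 1/2 keeps \<open>r\<close> positive.\<close>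
  define r where "r = sqrt (1 - min (1/2) (w / (16 * K)))"
  have \<theta>: "0 < \<theta>" "\<theta> \<le> 1" using \<nu> power_le_one[of \<nu> 2] by (auto simp: \<theta>_def)
  have w: "0 < w" using \<nu> by (simp add: w_def)
  have e: "0 < e" using tiny_dev \<theta> by (simp add: e_def)
  have c: "0 < c" using lam e by (simp add: c_def)
  have K: "0 < K" using rho by (simp add: K_def)
  have \<tau>: "0 < \<tau>" using c w by (simp add: \<tau>_def)
  define \<gamma> where "\<gamma> = min (1/2) (w / (16 * K))"
  have \<gamma>: "0 < \<gamma>" "\<gamma> \<le> 1/2" "K * \<gamma> \<le> w / 16"
  proof -
    show "0 < \<gamma>" "\<gamma> \<le> 1/2" using w K by (auto simp: \<gamma>_def)
    have "K * \<gamma> \<le> K * (w / (16 * K))" using K by (intro mult_left_mono) (auto simp: \<gamma>_def)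
    then show "K * \<gamma> \<le> w / 16" using K by simp
  qed
  have r: "0 < r" "r < 1" "1 - r\<^sup>2 = \<gamma>"
    using \<gamma> unfolding r_def \<gamma>_def[symmetric] by simp_all
  have conf: "(\<tau> / c) powr hyper_gain / c = w / 4"
    using c w hyper_gain by (simp add: \<tau>_def powr_powr)
  have main: "w / 8 \<le> E2 Ps (\<lambda>xs ys. f xs * f ys)"
    if g: "list_all good Ps" and f: "\<And>xs. 0 \<le> f xs \<and> f xs \<le> 1" and m: "\<nu> \<le> E1 Ps f"
      and i: "\<And>i. i < length Ps \<Longrightarrow> infl Ps i (smooth r Ps f) \<le> \<tau>" for Ps f
  proof -
    note k = list_good_kern[OF g]
    define s where "s = smooth r Ps f"
    define F where "F xs = \<theta> + (1 - \<theta>) * s xs" for xs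
    have s: "0 \<le> s xs" "s xs \<le> 1" for xs
      using smooth_range[OF k, of r f xs] r f by (auto simp: s_def)
    have F: "\<theta> \<le> F xs" "F xs \<le> 1" "s xs \<le> F xs" "F xs \<le> \<theta> + s xs" for xs
    proof -
      show "\<theta> \<le> F xs" using s \<theta> by (simp add: F_def)
      have *: "(1 - \<theta>) * s xs \<le> (1 - \<theta>) * 1" "\<theta> * s xs \<le> \<theta> * 1" "0 \<le> \<theta> * s xs"
        using mult_left_mono[OF s(2)[of xs], of "1 - \<theta>"] mult_left_mono[OF s(2)[of xs], of \<theta>] s(1)[of xs] \<theta>
        by simp_all
      then show "F xs \<le> 1" "s xs \<le> F xs" "F xs \<le> \<theta> + s xs"
        by (auto simp: F_def algebra_simps)
    qed
    have F0: "0 \<le> F xs" for xs using F(1)[of xs] \<theta> by linarith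
    have mF: "\<nu> \<le> E1 Ps F"
    proof -
      have "\<nu> \<le> E1 Ps s" using m E1_smooth[OF k, of r f] by (simp add: s_def)
      also have "\<dots> \<le> E1 Ps F" by (intro E1_mono k F)
      finally show ?thesis .
    qed
    have iF: "infl Ps j F \<le> \<tau>" if "j < length Ps" for j
    proof -
      have "infl Ps j F = (1 - \<theta>)\<^sup>2 * infl Ps j s" unfolding F_def by (rule infl_affine[OF k])
      also have "\<dots> \<le> 1 * \<tau>"
      \<comment> \<open>A distinction on the sign avoids a separate proof that influences are
        nonnegative.\<close>
      proof (cases "0 \<le> infl Ps j s")
        case True
        then show ?thesis using i[OF that] \<theta> \<tau> by (intro mult_mono) (auto simp: s_def power_le_one)
      next
        case False
        then have "(1 - \<theta>)\<^sup>2 * infl Ps j s \<le> 0" by (simp add: mult_le_0_iff)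
        then show ?thesis using \<tau> by simp
      qed
      finally show ?thesis by simp
    qed
    have "(\<Sum>i<length Ps. both_bad_prob e Ps i F F) \<le> w / 4"
      using sum_both_bad_prob_le[OF g e F0 F(2) iF] conf unfolding c_def by linarith
    moreover have "w \<le> E1 Ps F ^ sub_exp * E1 Ps F ^ sub_exp"
      unfolding w_def using mF \<nu> by (intro mult_mono power_mono) auto
    ultimately have "3 / 4 * w \<le> E2 Ps (\<lambda>xs ys. F xs ^ sub_exp * F ys ^ sub_exp)"
      using E2_submartingale[OF g \<theta>(1), of F F] F by (simp add: e_def)
    also have "\<dots> \<le> E2 Ps (\<lambda>xs ys. 2 * (s xs * s ys) + w / 4)"
    proof (intro E2_mono k)
      fix xs ys
      define z where "z = s xs * s ys"
      have z0: "0 \<le> z" using s by (simp add: z_def)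
      have FF: "0 \<le> F xs * F ys" "F xs * F ys \<le> 1" using F F0 by (auto intro: mult_le_one)
      have "F xs * F ys \<le> (\<theta> + s xs) * (\<theta> + s ys)" using F F0 \<theta> s by (intro mult_mono) auto
      also have "\<dots> = z + \<theta> * s xs + \<theta> * s ys + \<theta> * \<theta>" by (simp add: z_def algebra_simps)
      also have "\<dots> \<le> z + \<theta> * 1 + \<theta> * 1 + \<theta> * 1"
        using s \<theta> by (intro add_mono mult_left_mono) auto
      finally have up: "F xs * F ys \<le> z + 3 * \<theta>" by simp
      have "(F xs * F ys) ^ sub_exp \<le> 2 * z + w / 4"
      proof (cases "3 * \<theta> \<le> z")
        case True
        have "(F xs * F ys) ^ sub_exp \<le> (F xs * F ys) ^ 1" using FF sub_exp by (intro power_decreasing) auto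
        also have "\<dots> \<le> 2 * z" using up True by simp
        finally show ?thesis using w by simp
      next
        case False
        then have "F xs * F ys \<le> \<nu>\<^sup>2 / 2" using up by (simp add: \<theta>_def)
        then have "(F xs * F ys) ^ sub_exp \<le> (\<nu>\<^sup>2 / 2) ^ sub_exp" using FF by (intro power_mono) auto
        also have "\<dots> = w * (1/2) ^ sub_exp" by (simp add: w_def power_divide power_mult_distrib power2_eq_square)
        also have "\<dots> \<le> w * (1/2) ^ 2" using w sub_exp by (intro mult_left_mono power_decreasing) auto
        finally show ?thesis using z0 by (simp add: power2_eq_square)
      qed
      then show "F xs ^ sub_exp * F ys ^ sub_exp \<le> 2 * (s xs * s ys) + w / 4"
        by (simp add: z_def power_mult_distrib)
    qed
    also have "\<dots> = 2 * E2 Ps (\<lambda>xs ys. s xs * s ys) + w / 4"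
      by (simp only: E2_add E2_cmult E2_const[OF k])
    finally have low: "w / 4 \<le> E2 Ps (\<lambda>xs ys. s xs * s ys)" by simp
    \<comment> \<open>The upper bound on the defect becomes a lower bound for the pairing of
      \<open>f\<close> with itself when the second argument is negated.\<close>
    have "smoothing_defect r Ps 1 f (\<lambda>xs. -1 * f xs) \<le> (1 - 1 + K * (1 - r\<^sup>2)) / 2 *
        (E1 Ps (\<lambda>xs. (f xs)\<^sup>2) + E1 Ps (\<lambda>xs. (-1 * f xs)\<^sup>2))"
      unfolding K_def using r by (intro smoothing_defect_le[OF g]) auto
    then have "- smoothing_defect r Ps 1 f f \<le> (K * \<gamma>) * E1 Ps (\<lambda>xs. (f xs)\<^sup>2)"
      unfolding smoothing_defect_cmult_right r by simp
    also have "\<dots> \<le> (K * \<gamma>) * 1"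
      using K \<gamma> f by (intro mult_left_mono E1_le_const k) (auto simp: power_le_one)
    finally have "E2 Ps (\<lambda>xs ys. s xs * s ys) - w / 16 \<le> E2 Ps (\<lambda>xs ys. f xs * f ys)"
      using \<gamma>(3) by (simp add: smoothing_defect_def s_def)
    then show ?thesis using low w by linarith
  qed
  show ?thesis
    by (rule exI[of _ r], rule exI[of _ \<tau>], rule exI[of _ "w / 8"]) (use r \<tau> w main in auto)
qed

text \<open>Averaged over the fixed value, \<open>E1\<close> is preserved and \<open>energy\<close>
  increases, so some value increases their sum \<open>\<Psi>\<close>. Working with the sum retains
  control of the mean, because \<open>\<Psi> \<le> 2 * E1 Ps f\<close>.\<close>

theorem good_same_set_hitting:
  assumes \<mu>: "0 < \<mu>" "\<mu> \<le> 1"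
  shows "\<exists>\<delta>>0. \<forall>Ps f. list_all good Ps \<longrightarrow> (\<forall>xs. 0 \<le> f xs \<and> f xs \<le> 1) \<longrightarrow> \<mu> \<le> E1 Ps f \<longrightarrow>
    \<delta> \<le> E2 Ps (\<lambda>xs ys. f xs * f ys)"
proof -
  obtain r \<tau> d where r: "0 < r" "r < 1" and \<tau>: "0 < \<tau>" and d: "0 < d"
    and base: "\<And>Ps f. list_all good Ps \<Longrightarrow> (\<And>xs. 0 \<le> f xs \<and> f xs \<le> 1) \<Longrightarrow> \<mu> / 2 \<le> E1 Ps f \<Longrightarrow>
      (\<And>i. i < length Ps \<Longrightarrow> infl Ps i (smooth r Ps f) \<le> \<tau>) \<Longrightarrow> d \<le> E2 Ps (\<lambda>xs ys. f xs * f ys)"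
    using low_influence_hitting[of "\<mu> / 2"] \<mu> by auto
  define \<kappa> where "\<kappa> = (1 - r\<^sup>2) / r\<^sup>2 * \<tau>"
  have r2: "0 < r\<^sup>2" "r\<^sup>2 < 1" using r by (auto simp: power_less_one_iff)
  have \<kappa>: "0 < \<kappa>" using r2 \<tau> by (simp add: \<kappa>_def)
  define \<Psi> where "\<Psi> Ps f = E1 Ps f + energy r Ps f" for Ps f
  have \<Psi>_le: "\<Psi> Ps f \<le> 2 * E1 Ps f" "\<Psi> Ps f \<le> 2"
    if g: "list_all good Ps" and f: "\<And>xs. 0 \<le> f xs \<and> f xs \<le> 1" for Ps f
  proof -
    note k = list_good_kern[OF g]
    have "energy r Ps f \<le> E1 Ps (smooth r Ps f)"
      unfolding energy_def
    proof (intro E1_mono k)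
      fix xs
      show "(smooth r Ps f xs)\<^sup>2 \<le> smooth r Ps f xs"
        using smooth_range[OF k, of r f xs] r f by (simp add: power2_eq_square mult_left_le)
    qed
    then show 1: "\<Psi> Ps f \<le> 2 * E1 Ps f" by (simp add: \<Psi>_def E1_smooth[OF k])
    have "E1 Ps f \<le> 1" using f by (intro E1_le_const k) auto
    then show "\<Psi> Ps f \<le> 2" using 1 by linarith
  qed
  have \<Psi>_incr: "\<exists>a\<in>supp (Ps ! i). \<Psi> Ps f + \<kappa> \<le> \<Psi> Ps (restr i a f)"
    if g: "list_all good Ps" and i: "i < length Ps" "\<tau> < infl Ps i (smooth r Ps f)" for Ps f i
  proof (rule ex1_exists_ge)
    note k = list_good_kern[OF g]
    show "kern (Ps ! i)" using k i by (simp add: list_all_length)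
    have "\<kappa> \<le> (1 - r\<^sup>2) / r\<^sup>2 * infl Ps i (smooth r Ps f)"
      unfolding \<kappa>_def using i r2 by (intro mult_left_mono) auto
    then show "\<Psi> Ps f + \<kappa> \<le> ex1 (Ps ! i) (\<lambda>a. \<Psi> Ps (restr i a f))"
      using r by (simp add: \<Psi>_def ex1_add E1_restr[OF k i(1)] energy_restr[OF k i(1)])
  qed
  \<comment> \<open>Here \<open>n\<close> bounds the number of coordinates still to be fixed, each
    costing a factor \<open>lam\<close>. For \<open>n = 0\<close> the potential is already at its
    maximum 2, so no influence can exceed \<tau>.\<close>
  have iter: "lam ^ n * d \<le> E2 Ps (\<lambda>xs ys. f xs * f ys)"
    if g: "list_all good Ps" and f: "\<And>xs. 0 \<le> f xs \<and> f xs \<le> 1"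
      and \<Psi>: "\<mu> \<le> \<Psi> Ps f" "2 - real n * \<kappa> \<le> \<Psi> Ps f" for Ps f n
    using f \<Psi>
  proof (induction n arbitrary: f)
    case (0 f)
    have "infl Ps i (smooth r Ps f) \<le> \<tau>" if "i < length Ps" for i
    proof (rule ccontr)
      assume "\<not> ?thesis"
      then obtain a where "\<Psi> Ps f + \<kappa> \<le> \<Psi> Ps (restr i a f)"
        using \<Psi>_incr[OF g \<open>i < length Ps\<close>, of f] by auto
      moreover have "\<Psi> Ps (restr i a f) \<le> 2"
        using 0(1) by (intro \<Psi>_le(2)[OF g]) (auto simp: restr_def)
      ultimately show False using 0(3) \<kappa> by simp
    qed
    moreover have "\<mu> / 2 \<le> E1 Ps f" using \<Psi>_le(1)[OF g, of f] 0(1,2) by simp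
    ultimately show ?case using base[OF g, of f] 0(1) by simp
  next
    case (Suc n f)
    show ?case
    proof (cases "\<forall>i<length Ps. infl Ps i (smooth r Ps f) \<le> \<tau>")
      case True
      have "lam ^ Suc n * d \<le> 1 * d"
        using lam d by (intro mult_right_mono power_le_one) auto
      also have "1 * d \<le> E2 Ps (\<lambda>xs ys. f xs * f ys)"
        using base[OF g, of f] \<Psi>_le(1)[OF g, of f] Suc.prems(1,2) True by simp
      finally show ?thesis .
    next
      case False
      then obtain i where i: "i < length Ps" "\<tau> < infl Ps i (smooth r Ps f)" by force
      then obtain a where a: "a \<in> supp (Ps ! i)" "\<Psi> Ps f + \<kappa> \<le> \<Psi> Ps (restr i a f)"
        using \<Psi>_incr[OF g] by blast
      have "lam ^ n * d \<le> E2 Ps (\<lambda>xs ys. restr i a f xs * restr i a f ys)"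
      proof (intro Suc.IH)
        show "2 - real n * \<kappa> \<le> \<Psi> Ps (restr i a f)"
          using a Suc.prems(3) by (simp add: algebra_simps)
        show "\<mu> \<le> \<Psi> Ps (restr i a f)" using a Suc.prems(2) \<kappa> by linarith
      qed (use Suc.prems(1) in \<open>simp add: restr_def\<close>)
      then have "lam * (lam ^ n * d) \<le> lam * E2 Ps (\<lambda>xs ys. restr i a f xs * restr i a f ys)"
        using lam by (intro mult_left_mono) auto
      also have "\<dots> \<le> E2 Ps (\<lambda>xs ys. f xs * f ys)"
        using Suc.prems(1) by (intro E2_restr[OF g i(1) a(1)]) auto
      finally show ?thesis by (simp add: mult.assoc)
    qed
  qed
  define n where "n = nat \<lceil>2 / \<kappa>\<rceil>"
  have "2 / \<kappa> \<le> real n" unfolding n_def by (rule real_nat_ceiling_ge)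
  then have n: "2 \<le> real n * \<kappa>" using \<kappa> by (simp add: field_simps)
  show ?thesis
  proof (intro exI[of _ "lam ^ n * d"] conjI allI impI)
    show "0 < lam ^ n * d" using lam d by simp
    fix Ps f
    assume g: "list_all good Ps" and f: "\<forall>xs. 0 \<le> f xs \<and> f xs \<le> 1" and m: "\<mu> \<le> E1 Ps f"
    have "0 \<le> energy r Ps f" unfolding energy_def by (intro E1_nonneg list_good_kern[OF g]) auto
    then have "\<mu> \<le> \<Psi> Ps f" using m by (simp add: \<Psi>_def)
    then show "lam ^ n * d \<le> E2 Ps (\<lambda>xs ys. f xs * f ys)"
      using f n \<mu> by (intro iter g) auto
  qed
qed

end

section \<open>Decomposition into connected components\<close>

context alphabet
begin

text \<open>A product of mixtures is a nonnegative combination of products of components.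
  \<open>H\<close> is arbitrary because the induction integrates one coordinate into it.\<close>

lemma E2_mixture_nonneg:
  assumes "finite I" "\<And>k. k \<in> I \<Longrightarrow> 0 \<le> w k"
    and "\<And>x y. x \<in> A \<Longrightarrow> y \<in> A \<Longrightarrow> P x y = (\<Sum>k\<in>I. w k * Q k x y)"
    and "\<And>Ps. length Ps = n \<Longrightarrow> set Ps \<subseteq> Q ` I \<Longrightarrow> 0 \<le> E2 Ps H"
  shows "0 \<le> E2 (replicate n P) H"
  using assms(4)
proof (induction n arbitrary: H)
  case 0
  then show ?case using "0.prems"[of "[]"] by simp
next
  case (Suc n)
  define R where "R = replicate n P"
  have mix: "ex2 P h = (\<Sum>k\<in>I. w k * ex2 (Q k) h)" for h
  proof -
    have "ex2 P h = (\<Sum>x\<in>A. \<Sum>y\<in>A. \<Sum>k\<in>I. w k * (Q k x y * h x y))"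
      unfolding ex2_def by (intro sum.cong refl) (simp add: assms(3) sum_distrib_right mult.assoc)
    also have "\<dots> = (\<Sum>x\<in>A. \<Sum>k\<in>I. \<Sum>y\<in>A. w k * (Q k x y * h x y))"
      by (intro sum.cong refl sum.swap)
    also have "\<dots> = (\<Sum>k\<in>I. \<Sum>x\<in>A. \<Sum>y\<in>A. w k * (Q k x y * h x y))" by (rule sum.swap)
    finally show ?thesis by (simp add: ex2_def sum_distrib_left)
  qed
  have "0 \<le> ex2 (Q k) (\<lambda>x y. E2 R (\<lambda>xs ys. H (x # xs) (y # ys)))" if k: "k \<in> I" for k
  proof -
    have "0 \<le> E2 R (\<lambda>xs ys. ex2 (Q k) (\<lambda>x y. H (x # xs) (y # ys)))"
      unfolding R_def
    proof (intro Suc.IH)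
      fix Ps assume "length Ps = n" "set Ps \<subseteq> Q ` I"
      then show "0 \<le> E2 Ps (\<lambda>xs ys. ex2 (Q k) (\<lambda>x y. H (x # xs) (y # ys)))"
        using Suc.prems[of "Q k # Ps"] k by (simp add: E2_ex2)
    qed
    then show ?thesis by (simp add: E2_ex2)
  qed
  then have "0 \<le> (\<Sum>k\<in>I. w k * ex2 (Q k) (\<lambda>x y. E2 R (\<lambda>xs ys. H (x # xs) (y # ys))))"
    using assms(2) by (intro sum_nonneg mult_nonneg_nonneg) auto
  then show ?case by (simp add: mix R_def)
qed

lemma three_squares: "(a + b + c)\<^sup>2 \<le> 3 * (a\<^sup>2 + b\<^sup>2 + c\<^sup>2)" for a b c :: real
proof -
  have "0 \<le> (a - b)\<^sup>2 + (b - c)\<^sup>2 + (a - c)\<^sup>2" by simp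
  then show ?thesis by (simp add: power2_eq_square algebra_simps)
qed

text \<open>
  \<open>Q k\<close> is the law conditioned on the component of \<open>k\<close>.  Components are indexed by their
  elements, with weights \<open>w k\<close> that sum to the mass of the component over each of them.
\<close>

lemma component_decomposition:
  assumes p: "kern p" and lam: "0 < lam" "\<And>x. x \<in> A \<Longrightarrow> lam \<le> p x x"
  shows "\<exists>L\<ge>1. \<exists>Q w. (\<forall>k\<in>A. 0 \<le> w k \<and> kern (Q k) \<and> (\<forall>x\<in>supp (Q k). lam \<le> Q k x x) \<and>
     (\<forall>u v. \<forall>x\<in>supp (Q k). \<forall>y\<in>supp (Q k). (u x - v y)\<^sup>2 \<le> L * ex2 (Q k) (\<lambda>a b. (u a - v b)\<^sup>2))) \<and>
     (\<forall>x\<in>A. \<forall>y\<in>A. p x y = (\<Sum>k\<in>A. w k * Q k x y))"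
proof -
  define R where "R = {(x, y). x \<in> A \<and> y \<in> A \<and> 0 < p x y}"
  \<comment> \<open>Equivalence generated by the positive entries of \<open>p\<close>. It also
    describes the components of the bipartite graph, since the positive diagonal joins the two
    copies of each point.\<close>
  define E where "E = (R \<union> R\<inverse>)\<^sup>*"
  define C where "C k = {y \<in> A. (k, y) \<in> E}" for k
  define M where "M k = (\<Sum>x\<in>C k. mg p x)" for k
  define Q where "Q k x y = (if x \<in> C k then p x y / M k else 0)" for k x y
  have symE: "(x, y) \<in> E \<Longrightarrow> (y, x) \<in> E" for x y
    unfolding E_def by (rule symD[OF sym_rtrancl]) (auto simp: sym_def)
  have transE: "(x, y) \<in> E \<Longrightarrow> (y, z) \<in> E \<Longrightarrow> (x, z) \<in> E" for x y z
    unfolding E_def by (rule rtrancl_trans)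
  have RE: "(x, y) \<in> E" if "x \<in> A" "y \<in> A" "p x y \<noteq> 0" for x y
    using that kern_nonneg[OF p, of x y] unfolding E_def R_def by (intro r_into_rtrancl) auto
  have C_refl: "k \<in> A \<Longrightarrow> k \<in> C k" for k by (simp add: C_def E_def)
  have CA: "C k \<subseteq> A" "finite (C k)" for k using finite_A by (auto simp: C_def)
  have C_eq: "C k = C x" if "x \<in> C k" for x k
    using that symE transE unfolding C_def by blast
  have C_edge: "x \<in> C k \<longleftrightarrow> y \<in> C k" if "x \<in> A" "y \<in> A" "p x y \<noteq> 0" for x y k
    using that RE[OF that] symE transE unfolding C_def by blast
  have mgp: "lam \<le> mg p x" if "x \<in> A" for x
  proof -
    have "p x x \<le> mg p x" unfolding mg_def using finite_A that by (intro member_le_sum) (auto simp: kern_nonneg[OF p])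
    then show ?thesis using lam(2)[OF that] by simp
  qed
  have M: "0 < M k" "M k \<le> 1" if k: "k \<in> A" for k
  proof -
    have "mg p k \<le> M k" unfolding M_def using CA C_refl[OF k] mg_nonneg[OF p] by (intro member_le_sum) auto
    then show "0 < M k" using mgp[OF k] lam(1) by linarith
    have "M k \<le> (\<Sum>x\<in>A. mg p x)" unfolding M_def using CA finite_A mg_nonneg[OF p] by (intro sum_mono2) auto
    also have "\<dots> = 1" using ex1_const[OF p, of 1] by (simp add: ex1_def)
    finally show "M k \<le> 1" .
  qed
  have Q0: "0 \<le> Q k x y" if "k \<in> A" for k x y
    using M[OF that] kern_nonneg[OF p] by (auto simp: Q_def)
  have mgQ: "mg (Q k) x = (if x \<in> C k then mg p x / M k else 0)" for k x
    by (simp add: mg_def Q_def sum_divide_distrib)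
  have suppQ: "supp (Q k) = C k" if "k \<in> A" for k
    using M[OF that] mgp lam(1) CA(1)[of k] by (force simp: supp_def mgQ)
  have kQ: "kern (Q k)" if k: "k \<in> A" for k
    unfolding kern_def
  proof (intro conjI allI ballI)
    show "0 \<le> Q k x y" for x y by (rule Q0[OF k])
    have "ex2 (Q k) (\<lambda>_ _. 1) = (\<Sum>x\<in>A. mg (Q k) x)" by (simp add: ex2_def mg_def)
    also have "\<dots> = (\<Sum>x\<in>C k. mg p x / M k)"
      using CA finite_A by (simp add: mgQ sum.If_cases Int_absorb1)
    also have "\<dots> = 1" using M[OF k] by (simp add: M_def sum_divide_distrib[symmetric])
    finally show "ex2 (Q k) (\<lambda>_ _. 1) = 1" .
    fix y assume y: "y \<in> A"
    have "(\<Sum>x\<in>A. Q k x y) = (\<Sum>x\<in>A. if y \<in> C k then p x y / M k else 0)"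
      using C_edge y by (intro sum.cong refl) (auto simp: Q_def)
    also have "\<dots> = mg (Q k) y"
      using p y by (simp add: mgQ kern_def sum_divide_distrib[symmetric])
    finally show "(\<Sum>x\<in>A. Q k x y) = mg (Q k) y" .
  qed
  \<comment> \<open>Conditioning only increases the entries within a component, so bounds in terms
    of \<open>p\<close> serve all components at once.\<close>
  have Qp: "p x y \<le> Q k x y" if "k \<in> A" "x \<in> C k" for k x y
  proof -
    have "p x y * M k \<le> p x y * 1" using M[OF that(1)] kern_nonneg[OF p] by (intro mult_left_mono) auto
    then show ?thesis using M[OF that(1)] that(2) by (simp add: Q_def field_simps)
  qed
  have edge: "(u x - v y)\<^sup>2 \<le> 1 / p x y * ex2 (Q k) (\<lambda>a b. (u a - v b)\<^sup>2)"
    if "k \<in> A" "x \<in> C k" "y \<in> A" "0 < p x y" for k x y and u v :: "'a \<Rightarrow> real"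
  proof -
    have "p x y * (u x - v y)\<^sup>2 \<le> Q k x y * (u x - v y)\<^sup>2" using Qp that by (intro mult_right_mono) auto
    also have "\<dots> \<le> ex2 (Q k) (\<lambda>a b. (u a - v b)\<^sup>2)"
      using that CA by (intro ex2_ge_point kQ) auto
    finally show ?thesis using that by (simp add: field_simps)
  qed
  have diag: "(u x - v x)\<^sup>2 \<le> 1 / lam * ex2 (Q k) (\<lambda>a b. (u a - v b)\<^sup>2)"
    if "k \<in> A" "x \<in> C k" for k x and u v :: "'a \<Rightarrow> real"
  proof -
    have xA: "x \<in> A" using that CA by auto
    have px: "lam \<le> p x x" "0 < p x x" using lam(1) lam(2)[OF xA] by linarith+
    have "0 \<le> ex2 (Q k) (\<lambda>a b. (u a - v b)\<^sup>2)" by (intro ex2_nonneg kQ that) auto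
    moreover have "1 / p x x \<le> 1 / lam" using lam(1) px by (intro divide_left_mono) auto
    ultimately show ?thesis
      using edge[OF that xA px(2), of u v] by (meson mult_right_mono order_trans)
  qed
  \<comment> \<open>Induction along a path from \<open>x\<close> to \<open>y\<close>, with a
    constant depending only on the two ends.\<close>
  have chain: "\<exists>c\<ge>0. \<forall>k u v. k \<in> A \<longrightarrow> x \<in> C k \<longrightarrow> (u x - v y)\<^sup>2 \<le> c * ex2 (Q k) (\<lambda>a b. (u a - v b)\<^sup>2)"
    if "(x, y) \<in> E" for x y
    using that unfolding E_def
  proof (induction rule: rtrancl_induct)
    case base
    show ?case using diag lam by (intro exI[of _ "1 / lam"]) auto
  next
    case (step y z)
    then obtain c where c: "0 \<le> c" "\<And>k u v. k \<in> A \<Longrightarrow> x \<in> C k \<Longrightarrow> (u x - v y)\<^sup>2 \<le> c * ex2 (Q k) (\<lambda>a b. (u a - v b)\<^sup>2)"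
      by blast
    have yz: "y \<in> A" "z \<in> A" using step(2) by (auto simp: R_def)
    have xy: "(x, y) \<in> E" "(x, z) \<in> E" using step(1,2) by (auto simp: E_def intro: rtrancl_into_rtrancl)
    define q where "q = (if 0 < p y z then p y z else p z y)"
    have q: "0 < q" using step(2) by (auto simp: q_def R_def)
    show ?case
    proof (intro exI[of _ "3 * (c + 1 / lam + 1 / q)"] conjI allI impI)
      show "0 \<le> 3 * (c + 1 / lam + 1 / q)" using c q lam by simp
      fix k and u v :: "'a \<Rightarrow> real"
      assume k: "k \<in> A" "x \<in> C k"
      have Ck: "y \<in> C k" "z \<in> C k" using k(2) yz xy transE unfolding C_def by blast+
      define D where "D = ex2 (Q k) (\<lambda>a b. (u a - v b)\<^sup>2)"
      \<comment> \<open>Moving from \<open>v y\<close> to \<open>v z\<close> takes one edge and one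
        diagonal pair; the direction of the edge decides whether the diagonal pair sits at
        \<open>y\<close> or at \<open>z\<close>.\<close>
      have "\<exists>s t. u x - v z = (u x - v y) + s + t \<and> s\<^sup>2 \<le> 1 / lam * D \<and> t\<^sup>2 \<le> 1 / q * D"
      proof (cases "0 < p y z")
        case True
        then show ?thesis
          using diag[OF k(1) Ck(1), of u v] edge[OF k(1) Ck(1) yz(2), of u v]
          by (intro exI[of _ "v y - u y"] exI[of _ "u y - v z"]) (simp add: q_def D_def power2_commute)
      next
        case False
        then show ?thesis
          using diag[OF k(1) Ck(2), of u v] edge[OF k(1) Ck(2) yz(1), of u v] q
          by (intro exI[of _ "u z - v z"] exI[of _ "v y - u z"]) (simp add: q_def D_def power2_commute)
      qed
      then obtain s t where st: "u x - v z = (u x - v y) + s + t" "s\<^sup>2 \<le> 1 / lam * D" "t\<^sup>2 \<le> 1 / q * D"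
        by blast
      have "(u x - v z)\<^sup>2 \<le> 3 * ((u x - v y)\<^sup>2 + s\<^sup>2 + t\<^sup>2)" unfolding st(1) by (rule three_squares)
      also have "\<dots> \<le> 3 * (c * D + 1 / lam * D + 1 / q * D)"
        using c(2)[OF k, of u v] st by (intro mult_left_mono add_mono) (auto simp: D_def)
      finally show "(u x - v z)\<^sup>2 \<le> 3 * (c + 1 / lam + 1 / q) * ex2 (Q k) (\<lambda>a b. (u a - v b)\<^sup>2)"
        by (simp add: D_def algebra_simps)
    qed
  qed
  \<comment> \<open>Guarding by membership in \<open>E\<close> makes the constant a function of all
    pairs, whose finite sum then gives a single \<open>L\<close>.\<close>
  have "\<exists>c\<ge>0. (fst z, snd z) \<in> E \<longrightarrow> (\<forall>k u v. k \<in> A \<longrightarrow> fst z \<in> C k \<longrightarrow>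
      (u (fst z) - v (snd z))\<^sup>2 \<le> c * ex2 (Q k) (\<lambda>a b. (u a - v b)\<^sup>2))" for z
    using chain[of "fst z" "snd z"] by (cases "(fst z, snd z) \<in> E") auto
  then obtain c where c: "\<And>z. 0 \<le> c z" "\<And>x y k u v. (x, y) \<in> E \<Longrightarrow> k \<in> A \<Longrightarrow> x \<in> C k \<Longrightarrow>
      (u x - v y)\<^sup>2 \<le> c (x, y) * ex2 (Q k) (\<lambda>a b. (u a - v b)\<^sup>2)"
    by (metis fst_conv snd_conv)
  define L where "L = 1 + (\<Sum>z\<in>A \<times> A. c z)"
  have L: "1 \<le> L" using c(1) by (simp add: L_def sum_nonneg)
  have conn: "(u x - v y)\<^sup>2 \<le> L * ex2 (Q k) (\<lambda>a b. (u a - v b)\<^sup>2)"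
    if k: "k \<in> A" and xy: "x \<in> C k" "y \<in> C k" for k x y and u v :: "'a \<Rightarrow> real"
  proof -
    have E: "(x, y) \<in> E" using xy symE transE unfolding C_def by blast
    have "c (x, y) \<le> (\<Sum>z\<in>A \<times> A. c z)"
      using c(1) xy CA finite_A by (intro member_le_sum) auto
    then have "c (x, y) \<le> L" by (simp add: L_def)
    moreover have "0 \<le> ex2 (Q k) (\<lambda>a b. (u a - v b)\<^sup>2)" by (intro ex2_nonneg kQ k) auto
    ultimately show ?thesis using c(2)[OF E k xy(1), of u v] by (meson mult_right_mono order_trans)
  qed
  have mix: "p x y = (\<Sum>k\<in>A. mg p k * Q k x y)" if xy: "x \<in> A" "y \<in> A" for x y
  proof -
    have "(\<Sum>k\<in>A. mg p k * Q k x y) = (\<Sum>k\<in>A. if k \<in> C x then mg p k * (p x y / M x) else 0)"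
    proof (intro sum.cong refl)
      fix k assume "k \<in> A"
      then have "k \<in> C x \<longleftrightarrow> x \<in> C k" using xy symE by (auto simp: C_def)
      moreover have "M k = M x" if "x \<in> C k" using C_eq[OF that] by (simp add: M_def)
      ultimately show "mg p k * Q k x y = (if k \<in> C x then mg p k * (p x y / M x) else 0)"
        by (auto simp: Q_def)
    qed
    also have "\<dots> = (\<Sum>k\<in>C x. mg p k * (p x y / M x))"
      using CA finite_A by (simp add: sum.If_cases Int_absorb1)
    also have "\<dots> = M x * (p x y / M x)" by (simp only: M_def sum_distrib_right)
    also have "\<dots> = p x y" using M[OF xy(1)] by simp
    finally show ?thesis by simp
  qed
  have "lam \<le> Q k x x" if "k \<in> A" "x \<in> C k" for k x
    using Qp[OF that, of x] lam(2)[of x] that CA by force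
  then show ?thesis
    using L kQ conn mix suppQ mg_nonneg[OF p]
    by (intro exI[of _ L] conjI exI[of _ Q] exI[of _ "mg p"]) auto
qed

section \<open>Translation between pmfs and pair laws\<close>

lemma expectation_replicate_pmf:
  assumes "set_pmf P \<subseteq> A \<times> A"
  shows "measure_pmf.expectation (replicate_pmf n P) (\<lambda>zs. H (map fst zs) (map snd zs))
    = E2 (replicate n (\<lambda>x y. pmf P (x, y))) H"
proof (induction n arbitrary: H)
  case 0
  then show ?case by simp
next
  case (Suc n)
  have fin: "finite (set_pmf P)" using assms finite_A finite_subset by blast
  have finr: "finite (set_pmf (replicate_pmf n P))"
    by (rule finite_subset[OF _ finite_lists_length_eq[OF fin, of n]]) (auto simp: set_replicate_pmf)
  have rep: "replicate_pmf (Suc n) P = P \<bind> (\<lambda>z. map_pmf ((#) z) (replicate_pmf n P))"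
    by (simp add: map_pmf_def)
  have "measure_pmf.expectation (replicate_pmf (Suc n) P) (\<lambda>zs. H (map fst zs) (map snd zs))
      = (\<Sum>z\<in>A \<times> A. pmf P z * measure_pmf.expectation (map_pmf ((#) z) (replicate_pmf n P))
          (\<lambda>zs. H (map fst zs) (map snd zs)))"
    unfolding rep using assms finite_A finr by (subst pmf_expectation_bind[of "A \<times> A"]) auto
  also have "\<dots> = (\<Sum>z\<in>A \<times> A. pmf P z * E2 (replicate n (\<lambda>x y. pmf P (x, y))) (\<lambda>xs ys. H (fst z # xs) (snd z # ys)))"
    by (intro sum.cong refl) (simp add: Suc.IH[symmetric])
  also have "\<dots> = E2 (replicate (Suc n) (\<lambda>x y. pmf P (x, y))) H"
    by (simp add: ex2_def sum.cartesian_product case_prod_beta)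
  finally show ?case .
qed

lemma pmf_marginals:
  assumes "set_pmf P \<subseteq> A \<times> A" "x \<in> A"
  shows "(\<Sum>y\<in>A. pmf P (x, y)) = pmf (map_pmf fst P) x"
    and "(\<Sum>y\<in>A. pmf P (y, x)) = pmf (map_pmf snd P) x"
proof -
  have "pmf (map_pmf fst P) x = measure (measure_pmf P) (fst -` {x})" by (rule pmf_map)
  also have "\<dots> = measure (measure_pmf P) (Pair x ` A)"
    using assms by (intro measure_prob_cong_0) (auto simp: pmf_eq_0_set_pmf)
  also have "\<dots> = (\<Sum>y\<in>A. pmf P (x, y))"
    using finite_A by (simp add: measure_measure_pmf_finite sum.reindex inj_on_def)
  finally show "(\<Sum>y\<in>A. pmf P (x, y)) = pmf (map_pmf fst P) x" by simp
  have "pmf (map_pmf snd P) x = measure (measure_pmf P) (snd -` {x})" by (rule pmf_map)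
  also have "\<dots> = measure (measure_pmf P) ((\<lambda>y. (y, x)) ` A)"
    using assms by (intro measure_prob_cong_0) (auto simp: pmf_eq_0_set_pmf)
  also have "\<dots> = (\<Sum>y\<in>A. pmf P (y, x))"
    using finite_A by (simp add: measure_measure_pmf_finite sum.reindex inj_on_def)
  finally show "(\<Sum>y\<in>A. pmf P (y, x)) = pmf (map_pmf snd P) x" by simp
qed

end

theorem theorem1p5:
  fixes \<Omega> :: "'a set" and P :: "('a \<times> 'a) pmf" and \<pi> :: "'a pmf"
  assumes "finite \<Omega>"
    and "set_pmf P \<subseteq> \<Omega> \<times> \<Omega>"
    and "map_pmf fst P = \<pi>"
    and "map_pmf snd P = \<pi>"
    and "set_pmf \<pi> = \<Omega>"
  shows "same_set_hitting \<Omega> P \<longleftrightarrow> diag_min \<Omega> P > 0"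
proof -
  interpret alphabet \<Omega> by unfold_locales (rule assms(1))
  define p where "p x y = pmf P (x, y)" for x y
  have mgp: "mg p x = pmf \<pi> x" if "x \<in> \<Omega>" for x
    using pmf_marginals(1)[OF assms(2) that] assms(3) by (simp add: mg_def p_def)
  have expP: "measure_pmf.expectation (replicate_pmf n P) (\<lambda>zs. H (map fst zs) (map snd zs)) = E2 (replicate n p) H" for n H
    using expectation_replicate_pmf[OF assms(2), of n H] by (simp add: p_def[abs_def])
  have ne: "\<Omega> \<noteq> {}" using assms(5) set_pmf_not_empty by metis
  have kp: "kern p"
    unfolding kern_def
  proof (intro conjI allI ballI)
    show "0 \<le> p x y" for x y by (simp add: p_def)
    have "ex2 p (\<lambda>_ _. 1) = (\<Sum>z\<in>\<Omega> \<times> \<Omega>. pmf P z)"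
      by (simp add: ex2_def p_def sum.cartesian_product case_prod_beta)
    then show "ex2 p (\<lambda>_ _. 1) = 1" using assms(1,2) by (simp add: sum_pmf_eq_1)
    show "(\<Sum>x\<in>\<Omega>. p x y) = mg p y" if "y \<in> \<Omega>" for y
      using pmf_marginals(2)[OF assms(2) that] assms(4) mgp[OF that] by (simp add: p_def)
  qed
  show ?thesis
  proof
    assume hit: "same_set_hitting \<Omega> P"
    show "diag_min \<Omega> P > 0"
    proof (rule ccontr)
      assume "\<not> ?thesis"
      moreover have "diag_min \<Omega> P \<in> (\<lambda>x. pmf P (x, x)) ` \<Omega>"
        unfolding diag_min_def using assms(1) ne by (intro Min_in) auto
      ultimately obtain x where x: "x \<in> \<Omega>" "pmf P (x, x) = 0"
        using pmf_nonneg[of P] by (force simp: order_antisym)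
      define \<mu> where "\<mu> = pmf \<pi> x"
      have \<mu>: "\<mu> \<in> {0<..1}" using x assms(5) by (simp add: \<mu>_def pmf_le_1 pmf_positive)
      obtain \<delta> where \<delta>: "\<delta> \<in> {0<..1}" "is_same_set_hitting \<Omega> P \<mu> \<delta>"
        using hit \<mu> unfolding same_set_hitting_def by blast
      define f :: "'a list \<Rightarrow> real" where "f xs = of_bool (xs = [x])" for xs
      have "E2 (replicate 1 p) (\<lambda>xs ys. f xs) = \<mu>"
        using x assms(1) by (simp add: ex2_fst ex1_def f_def \<mu>_def mgp)
      moreover have "E2 (replicate 1 p) (\<lambda>xs ys. f ys) = \<mu>"
        using x assms(1) by (simp add: ex2_snd[OF kp] ex1_def f_def \<mu>_def mgp)
      moreover have "E2 (replicate 1 p) (\<lambda>xs ys. f xs * f ys) = 0"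
        using x by (simp add: ex2_def f_def p_def of_bool_def sum.neutral)
      ultimately show False
        using \<delta>(2)[unfolded is_same_set_hitting_def, rule_format, of 1 f] \<delta>(1)
        unfolding expP[of 1 "\<lambda>xs ys. f xs"] expP[of 1 "\<lambda>xs ys. f ys"] expP[of 1 "\<lambda>xs ys. f xs * f ys"]
        by (simp add: f_def)
    qed
  next
    assume pos: "diag_min \<Omega> P > 0"
    define lam where "lam = diag_min \<Omega> P"
    have lam: "lam \<le> p x x" if "x \<in> \<Omega>" for x
      unfolding lam_def diag_min_def p_def using assms(1) that by (intro Min_le) auto
    obtain x0 where "x0 \<in> \<Omega>" using ne by blast
    then have lam1: "0 < lam" "lam \<le> 1"
      using pos lam[of x0] pmf_le_1[of P "(x0, x0)"] by (auto simp: lam_def p_def)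
    obtain L Q w where L: "1 \<le> L"
      and Q: "\<forall>k\<in>\<Omega>. 0 \<le> w k \<and> kern (Q k) \<and> (\<forall>x\<in>supp (Q k). lam \<le> Q k x x) \<and>
        (\<forall>u v. \<forall>x\<in>supp (Q k). \<forall>y\<in>supp (Q k). (u x - v y)\<^sup>2 \<le> L * ex2 (Q k) (\<lambda>a b. (u a - v b)\<^sup>2))"
      and mix: "\<forall>x\<in>\<Omega>. \<forall>y\<in>\<Omega>. p x y = (\<Sum>k\<in>\<Omega>. w k * Q k x y)"
      using component_decomposition[OF kp lam1(1) lam] by blast
    interpret connected_alphabet \<Omega> lam L by unfold_locales (use lam1 L in auto)
    have goodQ: "good (Q k)" if "k \<in> \<Omega>" for k using Q that by (simp add: good_def)
    show "same_set_hitting \<Omega> P"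
      unfolding same_set_hitting_def
    proof
      fix \<mu> :: real assume \<mu>: "\<mu> \<in> {0<..1}"
      then obtain d where d: "0 < d" and hit: "\<And>Ps f. list_all good Ps \<Longrightarrow> (\<And>xs. 0 \<le> f xs \<and> f xs \<le> 1) \<Longrightarrow>
          \<mu> / 2 \<le> E1 Ps f \<Longrightarrow> d \<le> E2 Ps (\<lambda>xs ys. f xs * f ys)"
        using good_same_set_hitting[of "\<mu> / 2"] by auto
      \<comment> \<open>The linear bound below yields \<open>d * (\<mu> - \<mu> / 2)\<close>; the
        minimum keeps \<delta> in the required range.\<close>
      define \<delta> where "\<delta> = min 1 (d * (\<mu> / 2))"
      have "is_same_set_hitting \<Omega> P \<mu> \<delta>"
        unfolding is_same_set_hitting_def
      proof (intro allI impI)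
        fix n :: nat and f :: "'a list \<Rightarrow> real"
        assume f: "\<forall>xs. length xs = n \<and> set xs \<subseteq> \<Omega> \<longrightarrow> f xs \<in> {0..1}"
          and m: "\<mu> \<le> measure_pmf.expectation (replicate_pmf n P) (\<lambda>zs. f (map fst zs))"
        \<comment> \<open>Extension by 0, because the results on products ask for values in the unit
          interval at all lists.\<close>
        define g where "g xs = (if length xs = n \<and> set xs \<subseteq> \<Omega> then f xs else 0)" for xs
        have g: "0 \<le> g xs \<and> g xs \<le> 1" for xs using f by (simp add: g_def)
        have fg: "f (map fst zs) = g (map fst zs)" "f (map snd zs) = g (map snd zs)"
          if "zs \<in> set_pmf (replicate_pmf n P)" for zs
          using that assms(2) by (force simp: g_def set_replicate_pmf)+
        have m': "\<mu> \<le> E2 (replicate n p) (\<lambda>xs ys. g xs)"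
        proof -
          have "measure_pmf.expectation (replicate_pmf n P) (\<lambda>zs. f (map fst zs))
              = measure_pmf.expectation (replicate_pmf n P) (\<lambda>zs. g (map fst zs))"
            by (intro integral_cong_AE) (auto simp: AE_measure_pmf_iff fg)
          then show ?thesis using m expP[of n "\<lambda>xs ys. g xs"] by simp
        qed
        have kn: "list_all kern (replicate n p)" using kp by (simp add: list_all_length)
        \<comment> \<open>A lower bound on the mean need not pass to each component. The linear
          inequality \<open>E2 (g g) \<ge> d * (E1 g - \<mu> / 2)\<close> holds for every product of
          components, trivially when the mean is below \<open>\<mu> / 2\<close>, and survives
          mixing.\<close>
        have "0 \<le> E2 (replicate n p) (\<lambda>xs ys. g xs * g ys + ((- d) * g xs + d * (\<mu> / 2)))"
        proof (rule E2_mixture_nonneg[OF assms(1), of w _ Q])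
          fix Ps assume "length Ps = n" "set Ps \<subseteq> Q ` \<Omega>"
          then have gd: "list_all good Ps" using goodQ by (auto simp: list_all_iff)
          note k = list_good_kern[OF gd]
          have "0 \<le> E2 Ps (\<lambda>xs ys. g xs * g ys) - d * (E1 Ps g - \<mu> / 2)"
          proof (cases "\<mu> / 2 \<le> E1 Ps g")
            case True
            have "E1 Ps g \<le> 1" using g by (intro E1_le_const k) auto
            then have "d * (E1 Ps g - \<mu> / 2) \<le> d * 1" using d \<mu> by (intro mult_left_mono) auto
            then show ?thesis using hit[OF gd g True] by simp
          next
            case False
            then have "d * (E1 Ps g - \<mu> / 2) \<le> 0" using d by (simp add: mult_le_0_iff)
            moreover have "0 \<le> E2 Ps (\<lambda>xs ys. g xs * g ys)" using g by (intro E2_nonneg k) auto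
            ultimately show ?thesis by simp
          qed
          also have "\<dots> = E2 Ps (\<lambda>xs ys. g xs * g ys + ((- d) * g xs + d * (\<mu> / 2)))"
            by (simp only: E2_add E2_cmult E2_fst E1_const[OF k]) (simp add: algebra_simps)
          finally show "0 \<le> E2 Ps (\<lambda>xs ys. g xs * g ys + ((- d) * g xs + d * (\<mu> / 2)))" .
        qed (use Q mix in auto)
        also have "\<dots> = E2 (replicate n p) (\<lambda>xs ys. g xs * g ys)
            + ((- d) * E2 (replicate n p) (\<lambda>xs ys. g xs) + d * (\<mu> / 2))"
          by (simp only: E2_add E2_cmult E2_const[OF kn])
        finally have "d * (E2 (replicate n p) (\<lambda>xs ys. g xs) - \<mu> / 2) \<le> E2 (replicate n p) (\<lambda>xs ys. g xs * g ys)"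
          by (simp add: algebra_simps)
        moreover have "d * (\<mu> / 2) \<le> d * (E2 (replicate n p) (\<lambda>xs ys. g xs) - \<mu> / 2)"
          using m' d by (intro mult_left_mono) auto
        ultimately have "\<delta> \<le> E2 (replicate n p) (\<lambda>xs ys. g xs * g ys)" by (simp add: \<delta>_def)
        also have "\<dots> = measure_pmf.expectation (replicate_pmf n P) (\<lambda>zs. g (map fst zs) * g (map snd zs))"
          by (simp add: expP[of n "\<lambda>xs ys. g xs * g ys"])
        also have "\<dots> = measure_pmf.expectation (replicate_pmf n P) (\<lambda>zs. f (map fst zs) * f (map snd zs))"
          by (intro integral_cong_AE) (auto simp: AE_measure_pmf_iff fg)
        finally show "\<delta> \<le> measure_pmf.expectation (replicate_pmf n P) (\<lambda>zs. f (map fst zs) * f (map snd zs))" .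
      qed
      moreover have "\<delta> \<in> {0<..1}" using d \<mu> by (simp add: \<delta>_def)
      ultimately show "\<exists>\<delta>\<in>{0<..1}. is_same_set_hitting \<Omega> P \<mu> \<delta>" by blast
    qed
  qed
qed

end
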